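(* Let $a\in K$ and let $f\in F=\mathbb{C}((z))$ satisfy $\phi(f)=af$. If $f$ is $\partial$-algebraic over $K$, then $z^{-r}f\in K$ for some $r\in\mathbb{Z}$.
   Context: Fix a lattice $\Lambda_0\subset\mathbb{C}$ and let $\mathfrak{L}$ be its commensurability class. $K_\Lambda$ is the field of $\Lambda$-periodic meromorphic functions on $\mathbb{C}$ and $K=\bigcup_{\Lambda\in\mathfrak{L}}K_\Lambda$, embedded in $F=\mathbb{C}((z))$ via Laurent expansion at $0$. Fix an integer $q\ge 2$; $\phi f(z)=f(qz)$, $\partial=d/dz$. An element $f\in F$ is $\partial$-algebraic over $K$ if $P(f,\partial f,\dots,\partial^r f)=0$ for some nonzero $P\in K[X_0,\dots,X_r]$. *)

theory Defs
  imports "HOL-Complex_Analysis.Complex_Analysis" "HOL-Library.Poly_Mapping"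
begin

definition is_lattice :: "complex set \<Rightarrow> bool" where
  "is_lattice L \<longleftrightarrow>
     (\<exists>w1 w2. w1 \<noteq> 0 \<and> w2 / w1 \<notin> \<real> \<and>
        L = {of_int m * w1 + of_int n * w2 | m n. True})"

text \<open>Finite index of a subgroup: finitely many cosets.\<close>

definition finite_index :: "complex set \<Rightarrow> complex set \<Rightarrow> bool" where
  "finite_index H G \<longleftrightarrow> finite ((\<lambda>x. (+) x ` H) ` G)"

definition commensurable :: "complex set \<Rightarrow> complex set \<Rightarrow> bool" where
  "commensurable L M \<longleftrightarrow> finite_index (L \<inter> M) L \<and> finite_index (L \<inter> M) M"

definition commensurability_class :: "complex set \<Rightarrow> complex set set" where
  "commensurability_class L0 = {L. is_lattice L \<and> commensurable L0 L}"

text \<open>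
  Since a meromorphic function is represented by a total function, its value at a pole is
  a convention (here 0), and removable singularities have to be excluded: this is the purpose of
  \<^const>\<open>nicely_meromorphic_on\<close>, which makes the representation unique and pointwise
  periodicity meaningful.
\<close>

definition elliptic_functions :: "complex set \<Rightarrow> (complex \<Rightarrow> complex) set" where
  "elliptic_functions L =
     {g. g nicely_meromorphic_on UNIV \<and> (\<forall>w\<in>L. \<forall>z. g (z + w) = g z)}"

text \<open>
  The field \<open>K\<close>, as a subset of the formal Laurent series: it is the image of the union of all
  \<open>K\<^sub>L\<close>, where \<open>L\<close> is commensurable with \<open>L0\<close>, under Laurent expansion at 0.
\<close>

definition ell_field :: "complex set \<Rightarrow> complex fls set" where
  "ell_field L0 =
     {F. \<exists>L \<in> commensurability_class L0. \<exists>g \<in> elliptic_functions L. g has_laurent_expansion F}"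

text \<open>The operator \<open>f(z) \<mapsto> f(q z)\<close>.\<close>

definition phi :: "nat \<Rightarrow> complex fls \<Rightarrow> complex fls" where
  "phi q f = fls_compose_fps f (of_nat q * fps_X)"

text \<open>
  A polynomial in the variables \<open>X\<^sub>0, X\<^sub>1, \<dots>\<close> is a finitely supported map from monomials to
  coefficients, a monomial being a finitely supported map from variable indices to exponents.
\<close>

type_synonym 'a mvpoly = "(nat \<Rightarrow>\<^sub>0 nat) \<Rightarrow>\<^sub>0 'a"

definition mvpoly_ring :: "'a::zero set \<Rightarrow> nat \<Rightarrow> 'a mvpoly set" where
  "mvpoly_ring K r =
     {P. \<forall>m \<in> Poly_Mapping.keys P.
           Poly_Mapping.lookup P m \<in> K \<and> Poly_Mapping.keys m \<subseteq> {..r}}"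

definition mvpoly_eval :: "'a::comm_semiring_1 mvpoly \<Rightarrow> (nat \<Rightarrow> 'a) \<Rightarrow> 'a" where
  "mvpoly_eval P x =
     (\<Sum>m \<in> Poly_Mapping.keys P.
        Poly_Mapping.lookup P m * (\<Prod>i \<in> Poly_Mapping.keys m. x i ^ Poly_Mapping.lookup m i))"

definition diff_algebraic_over :: "complex fls set \<Rightarrow> complex fls \<Rightarrow> bool" where
  "diff_algebraic_over K f \<longleftrightarrow>
     (\<exists>r. \<exists>P \<in> mvpoly_ring K r. P \<noteq> 0 \<and> mvpoly_eval P (\<lambda>i. (fls_deriv ^^ i) f) = 0)"

end

theory Submission
  imports Defs
begin

text \<open>
  The series \<open>f\<close> converges and extends to a meromorphic function \<open>F\<close> on the plane with
  \<open>F(qz) = a(z) F(z)\<close>. Let \<open>L\<close> be a common period lattice of \<open>a\<close> and the coefficients of the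
  differential equation. For \<open>w \<in> L\<close> the quotient \<open>h\<^sub>w(z) = F(z + w) / F(z)\<close> satisfies
  \<open>h\<^bsub>qw\<^esub>(qz) = h\<^sub>w(z)\<close>, so \<open>F(z + q^k w) = F(z) h\<^sub>w(z / q^k)\<close>. All translates of \<open>F\<close> by \<open>L\<close>
  satisfy the same differential equation at \<open>z\<close>; as \<open>z / q^k \<rightarrow> 0\<close>, the identity theorem shows
  that \<open>h\<^sub>w\<close> together with the Euler-scaled derivatives of \<open>h\<^sub>w' / h\<^sub>w\<close> satisfies a polynomial relation
  with constant coefficients, independent of \<open>w\<close> and of the point. The ideal of all such relations is
  stable under a family of affine substitutions with weights \<open>0, 1, 2, \<dots>\<close>, and the weights
  being distinct forces a linear relation in a single variable: for some \<open>i\<close> and \<open>c\<close> the function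
  \<open>(F' / F)^(i) + c / z^(i+1)\<close> is \<open>L\<close>-periodic. By the functional equation this descends to
  \<open>i = 0\<close>, the constant is an integer \<open>n\<close> by comparing residues, and \<open>z^n F\<close> is multiplied by a
  character under translation by \<open>L\<close>, which is trivial on \<open>(q - 1) L\<close>.
\<close>

section \<open>Weighted polynomials and semigroups of affine maps\<close>

text \<open>
  Monomials are multisets of variable indices. Variable \<open>i\<close> has weight \<open>i\<close>, so that \<open>\<Sum>\<^sub># M\<close> is
  the weight of the monomial \<open>M\<close>; variable \<open>0\<close> stands for a multiplicative coordinate.
\<close>

definition mon :: "nat multiset \<Rightarrow> (nat \<Rightarrow> complex) \<Rightarrow> complex" where
  "mon M v = prod_mset (image_mset v M)"

definition ev :: "(nat multiset \<Rightarrow>\<^sub>0 complex) \<Rightarrow> (nat \<Rightarrow> complex) \<Rightarrow> complex" where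
  "ev P v = (\<Sum>M\<in>Poly_Mapping.keys P. Poly_Mapping.lookup P M * mon M v)"

section \<open>Evaluation of monomials and polynomials\<close>

lemma mon_empty [simp]: "mon {#} v = 1"
  by (simp add: mon_def)

lemma mon_add_mset [simp]: "mon (add_mset i M) v = v i * mon M v"
  by (simp add: mon_def)

lemma mon_replicate: "mon (replicate_mset n i) v = v i ^ n"
  by (induction n) auto

lemma mon_union: "mon (M + N) v = mon M v * mon N v"
  by (simp add: mon_def)

lemma ev_superset:
  assumes "finite A" "Poly_Mapping.keys P \<subseteq> A"
  shows "ev P v = (\<Sum>M\<in>A. Poly_Mapping.lookup P M * mon M v)"
  unfolding ev_def using assms
  by (intro sum.mono_neutral_left) (auto simp: in_keys_iff)

lemma ev_0 [simp]: "ev 0 v = 0"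
  by (simp add: ev_def)

lemma ev_add: "ev (P + Q) v = ev P v + ev Q v"
proof -
  let ?A = "Poly_Mapping.keys P \<union> Poly_Mapping.keys Q"
  have "Poly_Mapping.keys (P + Q) \<subseteq> ?A"
    by (rule Poly_Mapping.keys_add)
  thus ?thesis
    by (simp add: ev_superset[of ?A] lookup_add algebra_simps sum.distrib)
qed

lemma ev_single: "ev (Poly_Mapping.single M c) v = c * mon M v"
  by (subst ev_superset[of "{M}"]) (auto simp: lookup_single)

lemma ev_uminus: "ev (- P) v = - ev P v"
  by (simp add: ev_def sum_negf)

lemma ev_diff: "ev (P - Q) v = ev P v - ev Q v"
  using ev_add[of P "- Q" v] by (simp add: ev_uminus)

lemma ev_scale: "ev (Poly_Mapping.map ((*) c) P) v = c * ev P v"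
proof -
  have "Poly_Mapping.keys (Poly_Mapping.map ((*) c) P) \<subseteq> Poly_Mapping.keys P"
    by (auto simp: in_keys_iff map.rep_eq when_def)
  thus ?thesis
    by (subst ev_superset[of "Poly_Mapping.keys P"])
       (auto simp: ev_def sum_distrib_left map.rep_eq when_def in_keys_iff mult.assoc intro!: sum.cong)
qed

text \<open>Working with functions instead of coefficient tables makes closure under sums and
  products free of any bookkeeping of cancellations; \<open>S\<close> records which monomials may
  occur.\<close>

inductive polyfun :: "nat multiset set \<Rightarrow> ((nat \<Rightarrow> complex) \<Rightarrow> complex) \<Rightarrow> bool" for S where
  zero: "polyfun S (\<lambda>v. 0)"
| step: "polyfun S f \<Longrightarrow> M \<in> S \<Longrightarrow> polyfun S (\<lambda>v. f v + c * mon M v)"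

lemma polyfun_add:
  assumes "polyfun S f" "polyfun S g"
  shows "polyfun S (\<lambda>v. f v + g v)"
  using assms(2)
proof induction
  case zero
  thus ?case using assms(1) by simp
next
  case (step g M c)
  from polyfun.step[OF step.IH step.hyps(2), of c] show ?case
    by (simp add: add.assoc)
qed

lemma polyfun_mon: "M \<in> S \<Longrightarrow> polyfun S (\<lambda>v. c * mon M v)"
  using polyfun.step[OF polyfun.zero, of M S c] by simp

lemma polyfun_sum: "(\<And>i. i \<in> A \<Longrightarrow> polyfun S (f i)) \<Longrightarrow> polyfun S (\<lambda>v. \<Sum>i\<in>A. f i v)"
  by (induction A rule: infinite_finite_induct) (auto intro: polyfun.zero polyfun_add)

lemma polyfun_mult_mon:
  assumes "polyfun S f" "\<And>N. N \<in> S \<Longrightarrow> M + N \<in> S'"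
  shows "polyfun S' (\<lambda>v. c * mon M v * f v)"
  using assms(1)
proof induction
  case zero
  thus ?case by (simp add: polyfun.zero)
next
  case (step f N d)
  from polyfun.step[OF step.IH assms(2)[OF step.hyps(2)], of "c * d"] show ?case
    by (simp add: algebra_simps mon_union)
qed

lemma polyfun_mult:
  assumes "polyfun S f" "polyfun T g" "\<And>M N. M \<in> S \<Longrightarrow> N \<in> T \<Longrightarrow> M + N \<in> U"
  shows "polyfun U (\<lambda>v. f v * g v)"
  using assms(1)
proof induction
  case zero
  thus ?case by (simp add: polyfun.zero)
next
  case (step f M c)
  from polyfun_add[OF step.IH polyfun_mult_mon[OF assms(2), of M U c]] assms(3)[OF step.hyps(2)]
  show ?case by (simp add: algebra_simps)
qed

lemma polyfun_cmult: "polyfun S f \<Longrightarrow> polyfun S (\<lambda>v. c * f v)"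
  using polyfun_mult_mon[of S f "{#}" S c] by simp

lemma polyfun_mono: "polyfun S f \<Longrightarrow> S \<subseteq> T \<Longrightarrow> polyfun T f"
  by (induction rule: polyfun.induct) (auto intro: polyfun.intros)

text \<open>The way back from functions to polynomials. Terms that cancel only shrink the set of
  keys, so the bound \<open>S\<close> survives.\<close>

lemma polyfun_imp_ev:
  assumes "polyfun S f"
  shows "\<exists>P. Poly_Mapping.keys P \<subseteq> S \<and> f = ev P"
  using assms
proof induction
  case zero
  thus ?case by (intro exI[of _ 0]) auto
next
  case (step f M c)
  then obtain P where P: "Poly_Mapping.keys P \<subseteq> S" "f = ev P" by blast
  have "Poly_Mapping.keys (P + Poly_Mapping.single M c) \<subseteq> S"
    using Poly_Mapping.keys_add[of P "Poly_Mapping.single M c"] P step.hyps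
    by (auto split: if_splits)
  thus ?case using P by (intro exI[of _ "P + Poly_Mapping.single M c"]) (auto simp: ev_add ev_single)
qed

text \<open>A Kronecker substitution \<open>v\<^sub>i = t\<^bsup>s^i\<^esup>\<close> separates the monomials for suitable \<open>s\<close>.\<close>

lemma ev_nonzero:
  assumes "P \<noteq> 0"
  shows "\<exists>v. (\<forall>i. v i \<noteq> 0) \<and> ev P v \<noteq> 0"
proof -
  define K where "K = Poly_Mapping.keys P"
  \<comment> \<open>The coefficients of \<open>mp M\<close> are the multiplicities in
    \<open>M\<close>, so distinct monomials give distinct integer polynomials. Avoiding the finitely
    many roots of their differences yields an \<open>s\<close> at which all their values
    differ.\<close>
  define mp :: "nat multiset \<Rightarrow> int poly" where "mp M = (\<Sum>i\<in>#M. monom 1 i)" for M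
  have cmp: "coeff (mp M) i = int (count M i)" for M i
    by (induction M) (auto simp: mp_def)
  have inj_mp: "M = N" if "mp M = mp N" for M N
    by (rule multiset_eqI) (metis cmp that of_nat_eq_iff)
  have "finite (\<Union>M\<in>K. \<Union>N\<in>K-{M}. {s. poly (mp M - mp N) s = 0})"
    by (intro finite_UN_I finite_Diff poly_roots_finite) (use inj_mp in \<open>auto simp: K_def\<close>)
  moreover have "infinite (range int)" by (simp add: finite_image_iff)
  ultimately obtain s0 where s0: "s0 \<in> range int" "s0 \<notin> (\<Union>M\<in>K. \<Union>N\<in>K-{M}. {s. poly (mp M - mp N) s = 0})"
    by (meson finite_subset subsetI)
  then obtain s where s: "s0 = int s" by auto
  define w where "w M = (\<Sum>i\<in>#M. s ^ i)" for M
  have w: "poly (mp M) (int s) = int (w M)" for M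
    by (induction M) (auto simp: mp_def w_def poly_monom)
  have inj: "inj_on w K"
  proof (rule inj_onI)
    fix M N assume "M \<in> K" "N \<in> K" "w M = w N"
    with s0(2) s w show "M = N" by auto
  qed
  \<comment> \<open>\<open>R\<close> is \<open>P\<close> after the substitution. Injectivity of
    \<open>w\<close> excludes cancellation, and \<open>t \<noteq> 0\<close> keeps every coordinate
    nonzero, as is needed later for dividing by \<open>v 0\<close>.\<close>
  define R where "R = (\<Sum>M\<in>K. monom (Poly_Mapping.lookup P M) (w M))"
  obtain M0 where M0: "M0 \<in> K" using assms unfolding K_def by (metis ex_in_conv keys_eq_empty)
  have "coeff R (w M0) = (\<Sum>M\<in>K. if M = M0 then Poly_Mapping.lookup P M else 0)"
    unfolding R_def coeff_sum by (intro sum.cong) (use inj M0 in \<open>auto simp: inj_on_def\<close>)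
  also have "\<dots> \<noteq> 0" using M0 by (simp add: K_def in_keys_iff)
  finally have "R \<noteq> 0" by auto
  hence "finite (insert 0 {t. poly R t = 0})" by (simp add: poly_roots_finite)
  then obtain t where t: "t \<noteq> 0" "poly R t \<noteq> 0"
    using infinite_UNIV_char_0[where 'a = complex] by (metis (mono_tags, lifting) ex_new_if_finite insert_iff mem_Collect_eq)
  have "mon M (\<lambda>i. t ^ (s ^ i)) = t ^ w M" for M
    by (induction M) (auto simp: w_def power_add)
  hence "ev P (\<lambda>i. t ^ (s ^ i)) = poly R t"
    by (simp add: ev_def R_def poly_sum poly_monom K_def)
  with t show ?thesis by (intro exI[of _ "\<lambda>i. t ^ (s ^ i)"]) auto
qed

text \<open>Reduces questions along a line to polynomials in one variable, where finiteness of the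
  set of roots is available.\<close>

lemma ev_line: "\<exists>R. \<forall>u. ev P (\<lambda>i. x i + u * d i) = poly R u"
proof -
  have "\<exists>R. \<forall>u. mon M (\<lambda>i. x i + u * d i) = poly R u" for M
  proof (induction M)
    case empty
    show ?case by (intro exI[of _ 1]) auto
  next
    case (add i M)
    then obtain R where "\<forall>u. mon M (\<lambda>i. x i + u * d i) = poly R u" by blast
    thus ?case by (intro exI[of _ "[:x i, d i:] * R"]) (auto simp: algebra_simps)
  qed
  then obtain R where R: "\<And>M u. mon M (\<lambda>i. x i + u * d i) = poly (R M) u" by metis
  show ?thesis
    by (intro exI[of _ "\<Sum>M\<in>Poly_Mapping.keys P. smult (Poly_Mapping.lookup P M) (R M)"])
       (simp add: ev_def R poly_sum)
qed

section \<open>Affine substitutions compatible with the weight\<close>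

lemma mon_cong: "(\<And>i. i \<in> set_mset M \<Longrightarrow> v i = w i) \<Longrightarrow> mon M v = mon M w"
  by (simp add: mon_def cong: image_mset_cong)

lemma ev_cong:
  "(\<And>M i. M \<in> Poly_Mapping.keys P \<Longrightarrow> i \<in> set_mset M \<Longrightarrow> v i = w i) \<Longrightarrow> ev P v = ev P w"
  unfolding ev_def by (intro sum.cong refl arg_cong2[of _ _ _ _ "(*)"] mon_cong) auto

text \<open>Coordinate \<open>0\<close> will hold a quotient of function values, on which a change
  of base point acts by multiplication. The others hold scaled differences of derivatives of
  \<open>F' / F\<close>, on which it acts by a translation and by a power of \<open>\<rho>\<close>
  fixed by the weight.\<close>

definition aff :: "complex \<Rightarrow> (nat \<Rightarrow> complex) \<Rightarrow> complex \<Rightarrow> (nat \<Rightarrow> complex) \<Rightarrow> nat \<Rightarrow> complex" where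
  "aff h t \<rho> v = (\<lambda>i. if i = 0 then h * v 0 else t i + \<rho> ^ i * v i)"

text \<open>When the product is expanded, picking the constant \<open>t i\<close> from a factor of
  positive index lowers the weight by \<open>i\<close>. Variable \<open>0\<close> has weight
  \<open>0\<close> but no constant term, so every correction term has strictly smaller
  weight.\<close>

lemma mon_aff:
  "polyfun {N. \<Sum>\<^sub># N < \<Sum>\<^sub># M}
     (\<lambda>v. mon M (aff h t \<rho> v) - h ^ count M 0 * \<rho> ^ \<Sum>\<^sub># M * mon M v)"
proof (induction M)
  case empty
  show ?case by (simp add: polyfun.zero)
next
  case (add i M)
  define S where "S = {N. \<Sum>\<^sub># N < \<Sum>\<^sub># (add_mset i M)}"
  define g where "g = (\<lambda>v. mon M (aff h t \<rho> v) - h ^ count M 0 * \<rho> ^ \<Sum>\<^sub># M * mon M v)"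
  have g: "polyfun {N. \<Sum>\<^sub># N < \<Sum>\<^sub># M} g" using add by (simp add: g_def)
  have g1: "polyfun S (\<lambda>v. c * mon {#i#} v * g v)" for c
    by (rule polyfun_mult_mon[OF g]) (auto simp: S_def)
  show ?case
  proof (cases "i = 0")
    case True
    from g1[of h] have "polyfun S (\<lambda>v. h * v 0 * g v)" using True by simp
    thus ?thesis using True by (simp add: S_def aff_def g_def algebra_simps)
  next
    case False
    have g2: "polyfun S g" by (rule polyfun_mono[OF g]) (auto simp: S_def)
    have "polyfun S (\<lambda>v. t i * h ^ count M 0 * \<rho> ^ \<Sum>\<^sub># M * mon M v)"
      by (rule polyfun_mon) (use False in \<open>auto simp: S_def\<close>)
    from polyfun_add[OF this polyfun_add[OF polyfun_cmult[OF g2, of "t i"] g1[of "\<rho> ^ i"]]]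
    have "polyfun S (\<lambda>v. t i * h ^ count M 0 * \<rho> ^ \<Sum>\<^sub># M * mon M v + (t i * g v + \<rho> ^ i * v i * g v))"
      by simp
    also have "(\<lambda>v. t i * h ^ count M 0 * \<rho> ^ \<Sum>\<^sub># M * mon M v + (t i * g v + \<rho> ^ i * v i * g v)) =
      (\<lambda>v. mon (add_mset i M) (aff h t \<rho> v) - h ^ count (add_mset i M) 0 * \<rho> ^ \<Sum>\<^sub># (add_mset i M) * mon (add_mset i M) v)"
      using False by (auto simp: aff_def g_def algebra_simps power_add fun_eq_iff)
    finally show ?thesis by (simp add: S_def)
  qed
qed

text \<open>The corrections from \<open>mon_aff\<close> weigh less than the monomial they stem from
  and never reach weight \<open>W\<close>. Hence the coefficients of that weight are known
  exactly.\<close>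

lemma ev_aff:
  assumes W: "\<And>M. M \<in> Poly_Mapping.keys P \<Longrightarrow> \<Sum>\<^sub># M \<le> W"
  shows "\<exists>Q. (\<forall>v. ev Q v = ev P (aff h t \<rho> v)) \<and> (\<forall>M\<in>Poly_Mapping.keys Q. \<Sum>\<^sub># M \<le> W) \<and>
     (\<forall>M. \<Sum>\<^sub># M = W \<longrightarrow> Poly_Mapping.lookup Q M = h ^ count M 0 * \<rho> ^ W * Poly_Mapping.lookup P M)"
proof -
  have "\<exists>Q. Poly_Mapping.keys Q \<subseteq> {N. \<Sum>\<^sub># N < \<Sum>\<^sub># M} \<and>
     (\<lambda>v. mon M (aff h t \<rho> v) - h ^ count M 0 * \<rho> ^ \<Sum>\<^sub># M * mon M v) = ev Q" for M
    using polyfun_imp_ev[OF mon_aff] by blast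
  then obtain q where q: "\<And>M. Poly_Mapping.keys (q M) \<subseteq> {N. \<Sum>\<^sub># N < \<Sum>\<^sub># M}"
    "\<And>M v. mon M (aff h t \<rho> v) - h ^ count M 0 * \<rho> ^ \<Sum>\<^sub># M * mon M v = ev (q M) v"
    unfolding fun_eq_iff by metis
  define l where "l = Poly_Mapping.lookup P"
  define r where "r M = Poly_Mapping.single M (l M * (h ^ count M 0 * \<rho> ^ \<Sum>\<^sub># M)) + Poly_Mapping.map ((*) (l M)) (q M)" for M
  define Q where "Q = (\<Sum>M\<in>Poly_Mapping.keys P. r M)"
  have ev_sum: "ev (\<Sum>M\<in>A. r M) v = (\<Sum>M\<in>A. ev (r M) v)" for A v
    by (induction A rule: infinite_finite_induct) (auto simp: ev_add)
  have "ev (r M) v = l M * mon M (aff h t \<rho> v)" for M v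
    by (simp add: r_def ev_add ev_single ev_scale q(2)[symmetric] algebra_simps)
  hence 1: "ev Q v = ev P (aff h t \<rho> v)" for v
    by (simp add: Q_def ev_sum ev_def[of P] l_def)
  have lr: "Poly_Mapping.lookup (r M) N = (if N = M then l M * (h ^ count M 0 * \<rho> ^ \<Sum>\<^sub># M) else 0)"
    if "\<Sum>\<^sub># N \<ge> \<Sum>\<^sub># M" for M N
  proof -
    have "Poly_Mapping.lookup (q M) N = 0" using q(1)[of M] that by (auto simp: in_keys_iff subset_iff)
    thus ?thesis by (auto simp: r_def lookup_add lookup_single map.rep_eq when_def)
  qed
  have lQ: "Poly_Mapping.lookup Q N = h ^ count N 0 * \<rho> ^ \<Sum>\<^sub># N * l N" if "\<Sum>\<^sub># N \<ge> W" for N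
  proof -
    have "Poly_Mapping.lookup Q N = (\<Sum>M\<in>Poly_Mapping.keys P. Poly_Mapping.lookup (r M) N)"
      by (simp add: Q_def lookup_sum)
    also have "\<dots> = (\<Sum>M\<in>Poly_Mapping.keys P. if N = M then l M * (h ^ count M 0 * \<rho> ^ \<Sum>\<^sub># M) else 0)"
      using W that by (intro sum.cong refl lr) (metis order_trans)
    also have "\<dots> = h ^ count N 0 * \<rho> ^ \<Sum>\<^sub># N * l N"
      by (auto simp: l_def in_keys_iff)
    finally show ?thesis .
  qed
  have "\<Sum>\<^sub># M \<le> W" if "M \<in> Poly_Mapping.keys Q" for M
  proof (rule ccontr)
    assume *: "\<not> \<Sum>\<^sub># M \<le> W"
    hence "l M = 0" using W[of M] by (auto simp: l_def in_keys_iff)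
    with lQ[of M] * that show False by (auto simp: in_keys_iff)
  qed
  thus ?thesis using 1 lQ by (intro exI[of _ Q]) (auto simp: l_def)
qed

text \<open>In the application \<open>S\<close> consists of pairs of a period and a good point, and
  \<open>X\<close> of the vectors comparing jets. Only the ideal of polynomials vanishing on
  \<open>X\<close> is required to be stable, not \<open>X\<close> itself.\<close>

locale affine_semigroup =
  fixes S :: "'s set" and h \<rho> :: "'s \<Rightarrow> complex" and t :: "'s \<Rightarrow> nat \<Rightarrow> complex"
    and X :: "(nat \<Rightarrow> complex) set"
  assumes h_nz: "s \<in> S \<Longrightarrow> h s \<noteq> 0" and rho_nz: "s \<in> S \<Longrightarrow> \<rho> s \<noteq> 0"
  assumes stable: "(\<And>x. x \<in> X \<Longrightarrow> ev P x = 0) \<Longrightarrow> s \<in> S \<Longrightarrow> x \<in> X \<Longrightarrow> ev P (aff (h s) (t s) (\<rho> s) x) = 0"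
  assumes x_nz: "\<exists>x\<in>X. x 0 \<noteq> 0"
begin

abbreviation T where "T s \<equiv> aff (h s) (t s) (\<rho> s)"

lemma T_surj: "s \<in> S \<Longrightarrow> \<exists>x. T s x = y"
  using h_nz[of s] rho_nz[of s]
  by (intro exI[of _ "\<lambda>i. if i = 0 then y 0 / h s else (y i - t s i) / \<rho> s ^ i"])
     (auto simp: aff_def fun_eq_iff)

definition vanishing :: "(nat multiset \<Rightarrow>\<^sub>0 complex) \<Rightarrow> bool" where
  "vanishing P \<longleftrightarrow> (\<forall>x\<in>X. ev P x = 0)"

text \<open>
  Take a vanishing polynomial of least weight with the fewest terms of that weight: since \<open>T s\<close>
  multiplies the leading monomials by characters, subtracting a multiple of \<open>P\<close> from \<open>P \<circ> T s\<close>
  would otherwise produce a smaller one.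
\<close>

lemma semi_invariant_exists:
  assumes "vanishing P0" "P0 \<noteq> 0" and E1: "\<not> (\<exists>m>0. \<forall>s\<in>S. h s ^ m = 1)"
  shows "\<exists>P W k. P \<noteq> 0 \<and> (\<exists>M\<in>Poly_Mapping.keys P. \<Sum>\<^sub># M > 0) \<and>
           (\<forall>s\<in>S. \<forall>x. ev P (T s x) = h s ^ k * \<rho> s ^ W * ev P x)"
proof -
  define bdd where "bdd P W \<longleftrightarrow> (\<forall>M\<in>Poly_Mapping.keys P. \<Sum>\<^sub># M \<le> W)" for P :: "nat multiset \<Rightarrow>\<^sub>0 complex" and W
  define W where "W = (LEAST W. \<exists>P. P \<noteq> 0 \<and> vanishing P \<and> bdd P W)"
  have "bdd P0 (\<Sum>M\<in>Poly_Mapping.keys P0. \<Sum>\<^sub># M)"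
    unfolding bdd_def by (auto intro!: member_le_sum)
  with assms(1,2) have "\<exists>W P. P \<noteq> 0 \<and> vanishing P \<and> bdd P W" by blast
  from LeastI_ex[OF this] have "\<exists>P. P \<noteq> 0 \<and> vanishing P \<and> bdd P W" unfolding W_def .
  have minW: "P = 0" if "vanishing P" "\<And>M. M \<in> Poly_Mapping.keys P \<Longrightarrow> \<Sum>\<^sub># M < W" for P
  proof (rule ccontr)
    assume "P \<noteq> 0"
    then obtain M where "M \<in> Poly_Mapping.keys P" by (metis ex_in_conv keys_eq_empty)
    hence "W > 0" using that(2)[of M] by auto
    have "bdd P (W - 1)" unfolding bdd_def using that(2) \<open>W > 0\<close> by fastforce
    hence "W \<le> W - 1" unfolding W_def using \<open>P \<noteq> 0\<close> that(1) by (intro Least_le) blast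
    thus False using \<open>W > 0\<close> by simp
  qed
  define top where "top P = {M \<in> Poly_Mapping.keys P. \<Sum>\<^sub># M = W}" for P :: "nat multiset \<Rightarrow>\<^sub>0 complex"
  define C where "C = {P. P \<noteq> 0 \<and> vanishing P \<and> bdd P W}"
  have "\<exists>P\<in>C. \<forall>Q\<in>C. card (top P) \<le> card (top Q)"
    using \<open>\<exists>P. P \<noteq> 0 \<and> vanishing P \<and> bdd P W\<close> ex_has_least_nat[of "\<lambda>P. P \<in> C" _ "\<lambda>P. card (top P)"]
    unfolding C_def by blast
  then obtain P where P: "P \<noteq> 0" "vanishing P" "bdd P W"
    and minc: "\<And>Q. Q \<in> C \<Longrightarrow> card (top P) \<le> card (top Q)"
    unfolding C_def by blast
  have top_ne: "top P \<noteq> {}"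
    using minW[OF P(2)] P(1,3) by (force simp: top_def bdd_def)
  \<comment> \<open>The constant \<open>c\<close> is free, so that it can be chosen below to cancel
    a leading term while the result still vanishes on \<open>X\<close>.\<close>
  have transf: "\<exists>Q. vanishing Q \<and> bdd Q W \<and> (\<forall>v. ev Q v = ev P (T s v) - c * ev P v) \<and>
      (\<forall>M. \<Sum>\<^sub># M = W \<longrightarrow> Poly_Mapping.lookup Q M = (h s ^ count M 0 * \<rho> s ^ W - c) * Poly_Mapping.lookup P M)"
    if s: "s \<in> S" for s c
  proof -
    obtain Q where Q: "\<And>v. ev Q v = ev P (T s v)" "bdd Q W"
      "\<And>M. \<Sum>\<^sub># M = W \<Longrightarrow> Poly_Mapping.lookup Q M = h s ^ count M 0 * \<rho> s ^ W * Poly_Mapping.lookup P M"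
      using ev_aff[of P W "h s" "t s" "\<rho> s"] P(3) unfolding bdd_def by blast
    define R where "R = Q - Poly_Mapping.map ((*) c) P"
    have "vanishing R"
      using P(2) stable[of P s] s unfolding vanishing_def R_def by (simp add: ev_diff ev_scale Q)
    moreover have lR: "Poly_Mapping.lookup R M = Poly_Mapping.lookup Q M - c * Poly_Mapping.lookup P M" for M
      by (auto simp: R_def lookup_minus map.rep_eq when_def)
    moreover have "bdd R W"
      using Q(2) P(3) lR unfolding bdd_def by (force simp: in_keys_iff)
    ultimately show ?thesis
      by (intro exI[of _ R]) (auto simp: R_def ev_diff ev_scale Q lR algebra_simps)
  qed
  \<comment> \<open>Otherwise some \<open>s\<close> tells two leading monomials apart, and
    cancelling one of them while keeping the other contradicts the minimal number of leading terms.
    If no \<open>s\<close> did, one exponent \<open>m\<close> would give \<open>h s ^ m = 1\<close>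
    throughout, against \<open>E1\<close>.\<close>
  have same: "count M 0 = count N 0" if "M \<in> top P" "N \<in> top P" for M N
  proof (rule ccontr)
    assume neq: "count M 0 \<noteq> count N 0"
    have "\<forall>s\<in>S. h s ^ count M 0 = h s ^ count N 0"
    proof
      fix s assume s: "s \<in> S"
      show "h s ^ count M 0 = h s ^ count N 0"
      proof (rule ccontr)
        assume ne: "h s ^ count M 0 \<noteq> h s ^ count N 0"
        obtain Q where Q: "vanishing Q" "bdd Q W" 
          "\<And>K. \<Sum>\<^sub># K = W \<Longrightarrow> Poly_Mapping.lookup Q K = (h s ^ count K 0 * \<rho> s ^ W - h s ^ count M 0 * \<rho> s ^ W) * Poly_Mapping.lookup P K"
          using transf[OF s, of "h s ^ count M 0 * \<rho> s ^ W"] by blast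
        have "Poly_Mapping.lookup Q N \<noteq> 0"
          using Q(3)[of N] that(2) ne rho_nz[OF s] by (auto simp: top_def in_keys_iff)
        hence "Q \<in> C" unfolding C_def using Q by auto
        moreover have "top Q \<subset> top P"
        proof
          show "top Q \<subseteq> top P" using Q(3) by (auto simp: top_def in_keys_iff)
          have "M \<notin> top Q" using Q(3)[of M] by (auto simp: top_def in_keys_iff)
          thus "top Q \<noteq> top P" using that by blast
        qed
        hence "card (top Q) < card (top P)" by (intro psubset_card_mono) (auto simp: top_def)
        ultimately show False using minc[of Q] by simp
      qed
    qed
    moreover have "\<exists>m>0. \<forall>s\<in>S. h s ^ m = 1" if le: "a < b" "\<forall>s\<in>S. h s ^ a = h s ^ b" for a b :: nat
    proof (intro exI[of _ "b - a"] conjI ballI)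
      fix s assume "s \<in> S"
      have "h s ^ b = h s ^ a * h s ^ (b - a)" using le by (simp flip: power_add)
      thus "h s ^ (b - a) = 1" using le \<open>s \<in> S\<close> h_nz[of s] by auto
    qed (use le in auto)
    ultimately show False using E1 neq by (metis linorder_neqE_nat)
  qed
  obtain M0 where M0: "M0 \<in> top P" using top_ne by blast
  have inv: "ev P (T s x) = h s ^ count M0 0 * \<rho> s ^ W * ev P x" if s: "s \<in> S" for s x
  proof -
    obtain Q where Q: "vanishing Q" "bdd Q W" "\<And>v. ev Q v = ev P (T s v) - h s ^ count M0 0 * \<rho> s ^ W * ev P v"
      "\<And>K. \<Sum>\<^sub># K = W \<Longrightarrow> Poly_Mapping.lookup Q K = (h s ^ count K 0 * \<rho> s ^ W - h s ^ count M0 0 * \<rho> s ^ W) * Poly_Mapping.lookup P K"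
      using transf[OF s, of "h s ^ count M0 0 * \<rho> s ^ W"] by blast
    \<comment> \<open>All leading monomials are multiplied by the same character, so subtraction
      leaves only weights below \<open>W\<close>, and minimality of \<open>W\<close>
      applies.\<close>
    have "Q = 0"
    proof (rule minW[OF Q(1)])
      fix K assume K: "K \<in> Poly_Mapping.keys Q"
      have "\<Sum>\<^sub># K \<noteq> W"
      proof
        assume "\<Sum>\<^sub># K = W"
        with K Q(4)[of K] have "K \<in> top P" "h s ^ count K 0 \<noteq> h s ^ count M0 0" by (auto simp: top_def in_keys_iff)
        thus False using same[OF _ M0] by auto
      qed
      thus "\<Sum>\<^sub># K < W" using K Q(2) by (force simp: bdd_def)
    qed
    thus ?thesis using Q(3)[of x] by simp
  qed
  \<comment> \<open>In weight \<open>0\<close> only powers of variable \<open>0\<close> occur, and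
    \<open>same\<close> leaves just one; it cannot vanish at the point given by
    \<open>x_nz\<close>.\<close>
  have "W > 0"
  proof (rule ccontr)
    assume "\<not> W > 0"
    hence W0: "W = 0" by simp
    have rep: "K = replicate_mset (count K 0) 0" if "K \<in> Poly_Mapping.keys P" for K
    proof -
      have "\<Sum>\<^sub># K = 0" using that P(3) W0 by (auto simp: bdd_def)
      hence "set_mset K \<subseteq> {0}" by (metis le_zero_eq sum_mset_0_iff subsetI singletonI)
      thus ?thesis by (metis set_mset_subset_singletonD count_replicate_mset)
    qed
    have "K = M0" if "K \<in> Poly_Mapping.keys P" for K
    proof -
      have "K \<in> top P" using that P(3) W0 by (auto simp: top_def bdd_def)
      hence "count K 0 = count M0 0" using same M0 by blast
      thus ?thesis using rep[of K] rep[of M0] that M0 by (auto simp: top_def)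
    qed
    hence "Poly_Mapping.keys P = {M0}" using M0 by (auto simp: top_def)
    moreover have "mon M0 x = x 0 ^ count M0 0" for x
      using rep[of M0] M0 mon_replicate[of "count M0 0" 0 x] by (simp add: top_def)
    ultimately have "ev P x = Poly_Mapping.lookup P M0 * x 0 ^ count M0 0" for x
      by (simp add: ev_def)
    moreover obtain x where "x \<in> X" "x 0 \<noteq> 0" using x_nz by blast
    moreover have "Poly_Mapping.lookup P M0 \<noteq> 0" using M0 by (auto simp: top_def in_keys_iff)
    ultimately show False using P(2) by (auto simp: vanishing_def)
  qed
  thus ?thesis using P(1) M0 inv by (intro exI[of _ P] exI[of _ W] exI[of _ "count M0 0"]) (auto simp: top_def)
qed

text \<open>Invariance under \<open>d\<close> gives invariance under all natural multiples of
  \<open>d\<close>; a polynomial in one variable that is constant on the naturals is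
  constant.\<close>

lemma translation_scale:
  assumes "\<And>x. ev P (\<lambda>i. x i + d i) = ev P x"
  shows "ev P (\<lambda>i. x i + c * d i) = ev P x"
proof -
  obtain R where R: "\<And>u. ev P (\<lambda>i. x i + u * d i) = poly R u" using ev_line[of P x d] by blast
  have nat: "ev P (\<lambda>i. x i + of_nat n * d i) = ev P x" for n
  proof (induction n)
    case (Suc n)
    have "ev P (\<lambda>i. x i + of_nat (Suc n) * d i) = ev P (\<lambda>i. (x i + of_nat n * d i) + d i)"
      by (simp add: algebra_simps)
    thus ?case using assms Suc by simp
  qed auto
  have "R - [:ev P x:] = 0"
  proof (rule ccontr)
    assume "R - [:ev P x:] \<noteq> 0"
    hence "finite {u. poly (R - [:ev P x:]) u = 0}" by (rule poly_roots_finite)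
    moreover have "range of_nat \<subseteq> {u. poly (R - [:ev P x:]) u = 0}" using nat R by auto
    ultimately have "finite (range (of_nat :: nat \<Rightarrow> complex))" by (rule finite_subset[rotated])
    thus False by (simp add: finite_image_iff inj_of_nat)
  qed
  thus ?thesis using R[of c] by simp
qed

text \<open>
  A semi-invariant polynomial is invariant under the commutators of the maps \<open>T s\<close>, which are
  translations. If all of them together moved every coordinate of positive weight, the polynomial
  would not involve these coordinates.
\<close>

theorem dichotomy:
  assumes P0: "vanishing P0" "P0 \<noteq> 0"
    and root: "\<exists>s\<in>S. \<forall>n>0. \<rho> s ^ n \<noteq> 1"
  shows "(\<exists>m>0. \<forall>s\<in>S. h s ^ m = 1) \<or> (\<exists>j>0. \<exists>c. \<forall>s\<in>S. t s j = c * (1 - \<rho> s ^ j))"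
proof (rule ccontr)
  assume "\<not> ?thesis"
  hence E1: "\<not> (\<exists>m>0. \<forall>s\<in>S. h s ^ m = 1)" and E2: "\<And>j c. j > 0 \<Longrightarrow> \<exists>s\<in>S. t s j \<noteq> c * (1 - \<rho> s ^ j)" by blast+
  obtain P W k where P: "P \<noteq> 0" "\<exists>M\<in>Poly_Mapping.keys P. \<Sum>\<^sub># M > 0" 
    "\<And>s x. s \<in> S \<Longrightarrow> ev P (T s x) = h s ^ k * \<rho> s ^ W * ev P x"
    using semi_invariant_exists[OF P0 E1] by blast
  obtain s0 where s0: "s0 \<in> S" "\<And>n. n > 0 \<Longrightarrow> \<rho> s0 ^ n \<noteq> 1" using root by blast
  define Inv where "Inv = {d. \<forall>x. ev P (\<lambda>i. x i + d i) = ev P x}"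
  have Inv_scale: "(\<lambda>i. c * d i) \<in> Inv" if "d \<in> Inv" for c d
    using translation_scale[of P d] that by (simp add: Inv_def)
  have Inv_add: "(\<lambda>i. d i + e i) \<in> Inv" if "d \<in> Inv" "e \<in> Inv" for d e
    using that by (simp add: Inv_def flip: add.assoc)
  \<comment> \<open>Conjugating a translation by \<open>T s0\<close> rescales component
    \<open>i\<close> by \<open>\<rho> s0 ^ i\<close>, and the factors from the semi-invariance
    cancel.\<close>
  have Inv_rho: "(\<lambda>i. \<rho> s0 ^ i * d i) \<in> Inv" if "d \<in> Inv" "d 0 = 0" for d
  proof -
    have "ev P (\<lambda>i. y i + \<rho> s0 ^ i * d i) = ev P y" for y
    proof -
      obtain x where x: "T s0 x = y" using T_surj[OF s0(1)] by blast
      have "T s0 (\<lambda>i. x i + d i) = (\<lambda>i. y i + \<rho> s0 ^ i * d i)"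
        unfolding x[symmetric] using that by (auto simp: aff_def fun_eq_iff algebra_simps)
      thus ?thesis using P(3)[OF s0(1), of "\<lambda>i. x i + d i"] P(3)[OF s0(1), of x] x that by (simp add: Inv_def)
    qed
    thus ?thesis by (simp add: Inv_def)
  qed
  define V where "V = (\<Union>M\<in>Poly_Mapping.keys P. set_mset M)"
  have "finite V" by (auto simp: V_def)
  have Inv_cong: "e \<in> Inv" if "d \<in> Inv" "\<And>i. i \<in> V \<Longrightarrow> d i = e i" for d e
  proof -
    have "ev P (\<lambda>i. x i + e i) = ev P (\<lambda>i. x i + d i)" for x
      by (rule ev_cong) (use that(2) in \<open>force simp: V_def\<close>)
    thus ?thesis using that(1) by (simp add: Inv_def)
  qed
  have rho_inj: "\<rho> s0 ^ i \<noteq> \<rho> s0 ^ j" if "i < j" for i j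
  proof
    assume "\<rho> s0 ^ i = \<rho> s0 ^ j"
    also have "\<rho> s0 ^ j = \<rho> s0 ^ i * \<rho> s0 ^ (j - i)" using that by (simp flip: power_add)
    finally show False using rho_nz[OF s0(1)] s0(2)[of "j - i"] that by simp
  qed
  have unit: "(\<lambda>i. if i = j then c else 0) \<in> Inv" if j: "j > 0" for j c
  proof -
    \<comment> \<open>\<open>b\<close> is the fixed point of \<open>T s0\<close> on coordinate
      \<open>j\<close>. The map \<open>T s\<close> chosen next does not fix it, so the commutator
      moves this coordinate.\<close>
    define b where "b = t s0 j / (1 - \<rho> s0 ^ j)"
    obtain s where s: "s \<in> S" "t s j \<noteq> b * (1 - \<rho> s ^ j)" using E2[OF j] by blast
    \<comment> \<open>The displacement from \<open>T s0 (T s x)\<close> to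
      \<open>T s (T s0 x)\<close>. It is zero in coordinate \<open>0\<close>, where both maps are
      multiplications.\<close>
    define d where "d i = (if i = 0 then 0 else t s i + \<rho> s ^ i * t s0 i - t s0 i - \<rho> s0 ^ i * t s i)" for i
    have "ev P (\<lambda>i. y i + d i) = ev P y" for y
    proof -
      obtain x' where "T s0 x' = y" using T_surj[OF s0(1)] by blast
      moreover obtain x where "T s x = x'" using T_surj[OF s(1)] by blast
      ultimately have x: "T s0 (T s x) = y" by simp
      have "T s (T s0 x) = (\<lambda>i. y i + d i)"
        unfolding x[symmetric] by (auto simp: aff_def d_def fun_eq_iff algebra_simps)
      hence "ev P (\<lambda>i. y i + d i) = ev P (T s (T s0 x))" by simp
      also have "\<dots> = ev P (T s0 (T s x))"
        using s s0 by (simp add: P(3))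
      finally show ?thesis using x by simp
    qed
    hence d: "d \<in> Inv" "d 0 = 0" by (auto simp: Inv_def d_def)
    have "d j = t s j * (1 - \<rho> s0 ^ j) - t s0 j * (1 - \<rho> s ^ j)" using j by (simp add: d_def algebra_simps)
    hence dj: "d j \<noteq> 0" using s(2) s0(2)[OF j] by (auto simp: b_def field_simps)
    \<comment> \<open>Separation of eigenvalues: rescaling by \<open>Inv_rho\<close> and subtracting
      \<open>\<rho> s0 ^ i\<close> times the vector kills component \<open>i\<close>, but not
      component \<open>j\<close>, since the powers of \<open>\<rho> s0\<close> are distinct.\<close>
    have "\<exists>e\<in>Inv. e 0 = 0 \<and> e j \<noteq> 0 \<and> (\<forall>i\<in>K. e i = 0)" if "finite K" "K \<subseteq> V - {j}" for K
      using that
    proof (induction K rule: finite_induct)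
      case empty
      thus ?case using d dj by blast
    next
      case (insert i K)
      then obtain e where e: "e \<in> Inv" "e 0 = 0" "e j \<noteq> 0" "\<forall>i\<in>K. e i = 0" by auto
      define e' where "e' l = \<rho> s0 ^ l * e l + (- (\<rho> s0 ^ i)) * e l" for l
      have "e' \<in> Inv" unfolding e'_def by (intro Inv_add Inv_rho Inv_scale e)
      moreover have "\<rho> s0 ^ i \<noteq> \<rho> s0 ^ j" using rho_inj[of i j] rho_inj[of j i] insert.prems by (metis DiffE insertI1 insert_subset linorder_neqE_nat)
      hence "e' j \<noteq> 0" using e by (simp add: e'_def flip: left_diff_distrib)
      ultimately show ?case using e by (intro bexI[of _ e']) (auto simp: e'_def)
    qed
    from this[of "V - {j}"] obtain e where e: "e \<in> Inv" "e j \<noteq> 0" "\<forall>i\<in>V-{j}. e i = 0" using \<open>finite V\<close> by auto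
    have "(\<lambda>i. c / e j * e i) \<in> Inv" by (rule Inv_scale[OF e(1)])
    thus ?thesis by (rule Inv_cong) (use e in auto)
  qed
  have "(\<lambda>i. if i \<in> K then d i else 0) \<in> Inv" if "finite K" "0 \<notin> K" for K and d :: "nat \<Rightarrow> complex"
    using that
  proof (induction K rule: finite_induct)
    case empty
    thus ?case by (simp add: Inv_def)
  next
    case (insert j K)
    have "(\<lambda>i. (if i = j then d j else 0) + (if i \<in> K then d i else 0)) \<in> Inv"
      by (intro Inv_add unit insert.IH) (use insert.prems in auto)
    also have "(\<lambda>i. (if i = j then d j else 0) + (if i \<in> K then d i else 0)) = (\<lambda>i. if i \<in> insert j K then d i else 0)"
      using insert.hyps by auto
    finally show ?case .
  qed
  from this[of "V - {0}"] \<open>finite V\<close> have allInv: "(\<lambda>i. if i \<in> V - {0} then d i else 0) \<in> Inv" for d :: "nat \<Rightarrow> complex" by simp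
  define l where "l = Poly_Mapping.lookup P"
  \<comment> \<open>The weight-zero part is \<open>P\<close> with all coordinates of positive weight
    set to zero. Invariance under every translation of these coordinates forces
    \<open>P = P1\<close>, although \<open>P\<close> has a monomial of positive weight.\<close>
  define P1 where "P1 = (\<Sum>M\<in>{M\<in>Poly_Mapping.keys P. \<Sum>\<^sub># M = 0}. Poly_Mapping.single M (l M))"
  have ev_P1: "ev P1 x = ev P (\<lambda>i. if i = 0 then x 0 else 0)" for x
  proof -
    have "ev (\<Sum>M\<in>A. Poly_Mapping.single M (l M)) x = (\<Sum>M\<in>A. l M * mon M x)" for A
      by (induction A rule: infinite_finite_induct) (auto simp: ev_add ev_single)
    hence "ev P1 x = (\<Sum>M\<in>{M\<in>Poly_Mapping.keys P. \<Sum>\<^sub># M = 0}. l M * mon M x)" by (simp add: P1_def)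
    also have "\<dots> = (\<Sum>M\<in>Poly_Mapping.keys P. if \<Sum>\<^sub># M = 0 then l M * mon M x else 0)"
      by (simp add: sum.inter_filter)
    also have "\<dots> = (\<Sum>M\<in>Poly_Mapping.keys P. l M * mon M (\<lambda>i. if i = 0 then x 0 else 0))"
    proof (rule sum.cong)
      fix M
      show "(if \<Sum>\<^sub># M = 0 then l M * mon M x else 0) = l M * mon M (\<lambda>i. if i = 0 then x 0 else 0)"
      proof (cases "\<Sum>\<^sub># M = 0")
        case True
        hence "mon M x = mon M (\<lambda>i. if i = 0 then x 0 else 0)" by (intro mon_cong) auto
        thus ?thesis using True by simp
      next
        case False
        then obtain i where i: "i \<in># M" "i \<noteq> 0" by auto
        hence "mon M (\<lambda>i. if i = 0 then x 0 else 0) = 0" by (auto simp: mon_def prod_mset_zero_iff)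
        thus ?thesis using False by (simp only: if_False mult_zero_right)
      qed
    qed auto
    finally show ?thesis by (simp add: ev_def l_def)
  qed
  have "ev (P - P1) x = 0" for x
  proof -
    define x' where "x' = (\<lambda>i::nat. if i = 0 then x 0 else 0)"
    have "ev P (\<lambda>i. x' i + (if i \<in> V - {0} then x i else 0)) = ev P x'"
      using allInv[of x] by (simp add: Inv_def)
    also have "ev P (\<lambda>i. x' i + (if i \<in> V - {0} then x i else 0)) = ev P x"
      by (rule ev_cong) (auto simp: x'_def V_def)
    finally show ?thesis by (simp add: ev_diff ev_P1 x'_def)
  qed
  hence "P - P1 = 0" using ev_nonzero by blast
  hence "P = P1" by simp
  moreover have "Poly_Mapping.lookup P1 M = 0" if "\<Sum>\<^sub># M > 0" for M
    using that
    by (auto simp: P1_def lookup_sum lookup_single when_def simp del: sum_mset_0_iff intro!: sum.neutral)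
  ultimately show False using P(2) by (auto simp: in_keys_iff)
qed

end

section \<open>Lattices and the meromorphic extension of a solution\<close>

lemma lattice_add: "is_lattice L \<Longrightarrow> x \<in> L \<Longrightarrow> y \<in> L \<Longrightarrow> x + y \<in> L"
proof -
  assume "is_lattice L" "x \<in> L" "y \<in> L"
  then obtain w1 w2 where L: "L = {of_int m * w1 + of_int n * w2 | m n. True}" unfolding is_lattice_def by blast
  obtain a b c d where "x = of_int a * w1 + of_int b * w2" "y = of_int c * w1 + of_int d * w2"
    using \<open>x \<in> L\<close> \<open>y \<in> L\<close> L by blast
  hence "x + y = of_int (a + c) * w1 + of_int (b + d) * w2" by (simp add: algebra_simps)
  thus "x + y \<in> L" unfolding L by blast
qed

lemma lattice_uminus: "is_lattice L \<Longrightarrow> x \<in> L \<Longrightarrow> - x \<in> L"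
proof -
  assume "is_lattice L" "x \<in> L"
  then obtain w1 w2 where L: "L = {of_int m * w1 + of_int n * w2 | m n. True}" unfolding is_lattice_def by blast
  obtain a b where "x = of_int a * w1 + of_int b * w2"
    using \<open>x \<in> L\<close> L by blast
  hence "- x = of_int (- a) * w1 + of_int (- b) * w2" by (simp add: algebra_simps)
  thus "- x \<in> L" unfolding L by blast
qed

lemma lattice_nonempty: "is_lattice L \<Longrightarrow> \<exists>x. x \<in> L"
  unfolding is_lattice_def by blast

lemma lattice_0: "is_lattice L \<Longrightarrow> 0 \<in> L"
  using lattice_add[of L _ "- _"] lattice_uminus lattice_nonempty by (metis add.right_inverse)

lemma lattice_of_nat: "is_lattice L \<Longrightarrow> x \<in> L \<Longrightarrow> of_nat n * x \<in> L"
  by (induction n) (auto simp: lattice_0 lattice_add algebra_simps)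

lemma lattice_of_int: "is_lattice L \<Longrightarrow> x \<in> L \<Longrightarrow> of_int n * x \<in> L"
  using lattice_of_nat[of L x] lattice_uminus[of L] by (cases n) (auto simp del: of_nat_Suc)

lemma lattice_countable: "is_lattice L \<Longrightarrow> countable L"
proof -
  assume "is_lattice L"
  then obtain w1 w2 where L: "L = {of_int m * w1 + of_int n * w2 | m n. True}" unfolding is_lattice_def by blast
  have "L = (\<lambda>(m, n). of_int m * w1 + of_int n * w2) ` UNIV" unfolding L by auto
  thus ?thesis by simp
qed

lemma lattice_nonzero: "is_lattice L \<Longrightarrow> \<exists>w\<in>L. w \<noteq> 0"
proof -
  assume "is_lattice L"
  then obtain w1 w2 where L: "w1 \<noteq> 0" "L = {of_int m * w1 + of_int n * w2 | m n. True}" unfolding is_lattice_def by blast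
  have "of_int 1 * w1 + of_int 0 * w2 \<in> L" unfolding L(2) by blast
  thus ?thesis using L(1) by auto
qed

lemma is_lattice_scale: "is_lattice L \<Longrightarrow> N > 0 \<Longrightarrow> is_lattice ((*) (of_nat N) ` L)"
proof -
  assume "is_lattice L" "N > 0"
  then obtain w1 w2 where L: "w1 \<noteq> 0" "w2 / w1 \<notin> \<real>" "L = {of_int m * w1 + of_int n * w2 | m n. True}" unfolding is_lattice_def by blast
  have "of_nat N * (of_int m * w1 + of_int n * w2) = of_int m * (of_nat N * w1) + of_int n * (of_nat N * w2)" for m n
    by (simp add: algebra_simps)
  hence "(*) (of_nat N) ` L = {of_int m * (of_nat N * w1) + of_int n * (of_nat N * w2) | m n. True}"
    unfolding L(3) image_Collect by metis
  thus ?thesis unfolding is_lattice_def using L \<open>N > 0\<close>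
    by (intro exI[of _ "of_nat N * w1"] exI[of _ "of_nat N * w2"]) auto
qed

lemma lattice_coset_eq: "is_lattice L \<Longrightarrow> x - y \<in> L \<Longrightarrow> (+) x ` L = (+) y ` L"
proof -
  assume L: "is_lattice L" and xy: "x - y \<in> L"
  have "(+) a ` L \<subseteq> (+) b ` L" if "a - b \<in> L" for a b
  proof
    fix z assume "z \<in> (+) a ` L"
    then obtain w where "w \<in> L" "z = a + w" by blast
    hence "z = b + ((a - b) + w)" "(a - b) + w \<in> L" using lattice_add[OF L that] by auto
    thus "z \<in> (+) b ` L" by blast
  qed
  from this[of x y] this[of y x] show ?thesis using xy lattice_uminus[OF L xy] by auto
qed

text \<open>Reducing both integer coordinates modulo \<open>N\<close> represents every coset by one
  of \<open>N ^ 2\<close> points.\<close>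

lemma scale_in_commensurability_class:
  assumes L: "is_lattice L" and N: "N > 0"
  shows "(*) (of_nat N) ` L \<in> commensurability_class L"
proof -
  define M where "M = (*) (of_nat N :: complex) ` L"
  have M: "is_lattice M" unfolding M_def by (rule is_lattice_scale[OF L N])
  have sub: "M \<subseteq> L" unfolding M_def using lattice_of_nat[OF L] by auto
  hence int: "L \<inter> M = M" by blast
  have "finite_index M M"
  proof -
    have "(\<lambda>x. (+) x ` M) ` M \<subseteq> {M}"
      using lattice_coset_eq[OF M, of _ 0] by auto
    thus ?thesis unfolding finite_index_def using finite_subset by blast
  qed
  moreover have "finite_index M L"
  proof -
    obtain w1 w2 where w: "L = {of_int m * w1 + of_int n * w2 | m n. True}" using L unfolding is_lattice_def by blast
    have "(\<lambda>x. (+) x ` M) ` L \<subseteq> (\<lambda>(m, n). (+) (of_int m * w1 + of_int n * w2) ` M) ` ({0..<int N} \<times> {0..<int N})"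
    proof safe
      fix x assume "x \<in> L"
      then obtain m n where x: "x = of_int m * w1 + of_int n * w2" using w by blast
      define y where "y = of_int (m mod int N) * w1 + of_int (n mod int N) * w2"
      have mod: "of_int i - of_int (i mod int N) = (of_nat N * of_int (i div int N) :: complex)" for i
        by (metis of_int_diff of_int_mult of_int_of_nat_eq minus_mod_eq_mult_div)
      have "x - y = (of_int m - of_int (m mod int N)) * w1 + (of_int n - of_int (n mod int N)) * w2"
        unfolding x y_def by (simp add: algebra_simps)
      hence "x - y = of_nat N * (of_int (m div int N) * w1 + of_int (n div int N) * w2)"
        by (simp only: mod) (simp add: algebra_simps)
      moreover have "of_int (m div int N) * w1 + of_int (n div int N) * w2 \<in> L" using w by blast
      ultimately have "x - y \<in> M" unfolding M_def by auto
      hence "(+) x ` M = (+) y ` M" by (rule lattice_coset_eq[OF M])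
      thus "(+) x ` M \<in> (\<lambda>(m, n). (+) (of_int m * w1 + of_int n * w2) ` M) ` ({0..<int N} \<times> {0..<int N})"
        unfolding y_def using N by (intro image_eqI[of _ _ "(m mod int N, n mod int N)"]) auto
    qed
    thus ?thesis unfolding finite_index_def by (rule finite_subset) auto
  qed
  ultimately show ?thesis using M int unfolding commensurability_class_def commensurable_def M_def by simp
qed

text \<open>Pigeonhole: two different multiples of \<open>x\<close> lie in the same coset, and their
  difference is a multiple of \<open>x\<close> in \<open>H\<close>.\<close>

lemma finite_index_multiple:
  assumes "finite_index H G" "0 \<in> H" "\<And>n::nat. of_nat n * x \<in> G"
    and grp: "\<And>u v. u \<in> H \<Longrightarrow> v \<in> H \<Longrightarrow> u - v \<in> H"
  shows "\<exists>n>0. of_nat n * x \<in> H"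
proof -
  have "finite (range (\<lambda>n::nat. (+) (of_nat n * x) ` H))"
    using assms(1,3) unfolding finite_index_def by (auto intro: finite_subset[rotated])
  hence "\<not> inj (\<lambda>n::nat. (+) (of_nat n * x) ` H)"
    using finite_imageD infinite_UNIV_nat by blast
  then obtain m n :: nat where mn: "m < n" "(+) (of_nat m * x) ` H = (+) (of_nat n * x) ` H"
    unfolding inj_def by (metis linorder_neqE_nat)
  have "of_nat n * x \<in> (+) (of_nat m * x) ` H" using mn(2) assms(2) by force
  then obtain h where h: "h \<in> H" "of_nat n * x = of_nat m * x + h" by blast
  hence "of_nat (n - m) * x = h" using mn(1) by (simp add: of_nat_diff algebra_simps)
  thus ?thesis using h mn(1) by (intro exI[of _ "n - m"]) auto
qed

text \<open>It suffices to treat the two generators of \<open>L0\<close>; the product of the two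
  multipliers serves both.\<close>

lemma commensurable_multiple:
  assumes L0: "is_lattice L0" and L: "L \<in> commensurability_class L0"
  shows "\<exists>N>0. (*) (of_nat N) ` L0 \<subseteq> L"
proof -
  have lat: "is_lattice L" and fi: "finite_index (L0 \<inter> L) L0"
    using L unfolding commensurability_class_def commensurable_def by auto
  obtain w1 w2 where w: "L0 = {of_int m * w1 + of_int n * w2 | m n. True}" using L0 unfolding is_lattice_def by blast
  have "of_int 1 * w1 + of_int 0 * w2 \<in> L0" "of_int 0 * w1 + of_int 1 * w2 \<in> L0" unfolding w by blast+
  hence w12: "w1 \<in> L0" "w2 \<in> L0" by auto
  have *: "\<exists>n>0. of_nat n * x \<in> L0 \<inter> L" if "x \<in> L0" for x
    using fi
  proof (rule finite_index_multiple)
    show "u - v \<in> L0 \<inter> L" if "u \<in> L0 \<inter> L" "v \<in> L0 \<inter> L" for u v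
      using that lattice_add[OF L0, of u "- v"] lattice_add[OF lat, of u "- v"] lattice_uminus[OF L0, of v] lattice_uminus[OF lat, of v] by auto
  qed (use L0 lat that lattice_0 lattice_of_nat in auto)
  obtain m n where mn: "m > 0" "n > 0" "of_nat m * w1 \<in> L" "of_nat n * w2 \<in> L"
    using *[OF w12(1)] *[OF w12(2)] by blast
  have "of_nat (m * n) * x \<in> L" if "x \<in> L0" for x
  proof -
    obtain i j where x: "x = of_int i * w1 + of_int j * w2" using w \<open>x \<in> L0\<close> by blast
    have "of_int (i * int n) * (of_nat m * w1) + of_int (j * int m) * (of_nat n * w2) \<in> L"
      by (intro lattice_add lattice_of_int lat mn)
    thus ?thesis unfolding x by (simp add: algebra_simps)
  qed
  thus ?thesis using mn by (intro exI[of _ "m * n"]) auto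
qed

lemma common_multiple_lattice:
  assumes L0: "is_lattice L0" and "finite A" "A \<subseteq> commensurability_class L0"
  shows "\<exists>N>0. \<forall>L\<in>A. (*) (of_nat N) ` L0 \<subseteq> L"
  using assms(2,3)
proof (induction A rule: finite_induct)
  case empty
  thus ?case by (intro exI[of _ 1]) auto
next
  case (insert L A)
  then obtain N where N: "N > 0" "\<And>L. L \<in> A \<Longrightarrow> (*) (of_nat N) ` L0 \<subseteq> L" by auto
  obtain n where n: "n > 0" "(*) (of_nat n) ` L0 \<subseteq> L" using commensurable_multiple[OF L0, of L] insert.prems by auto
  have sub: "(*) (of_nat (n * k)) ` L0 \<subseteq> (*) (of_nat n) ` L0" for n k
    using lattice_of_nat[OF L0, of _ k] by (force simp: mult.assoc)
  have "(*) (of_nat (n * N)) ` L0 \<subseteq> L'" if "L' \<in> insert L A" for L'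
    using that sub[of n N] sub[of N n] N(2)[of L'] n(2) by (metis insertE mult.commute subset_trans)
  thus ?case using N n by (intro exI[of _ "n * N"]) auto
qed

lemma ell_field_0: "is_lattice L0 \<Longrightarrow> 0 \<in> ell_field L0"
  using scale_in_commensurability_class[of L0 1]
  unfolding ell_field_def elliptic_functions_def
  by (auto intro!: bexI exI[of _ "\<lambda>_. 0"])

section \<open>Convergence and meromorphic continuation of solutions\<close>

lemma phi_nth: "fls_nth (phi q f) n = of_nat q powi n * fls_nth f n" if q: "q > 0"
proof -
  define m where "m = fls_subdegree f"
  have X: "fps_to_fls (of_nat q * fps_X :: complex fps) = fls_const (of_nat q) * fls_X"
    by (simp add: fls_times_fps_to_fls fls_of_nat)
  hence Xp: "fps_to_fls (of_nat q * fps_X :: complex fps) powi m = fls_const (of_nat q powi m) * fls_X_intpow m"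
    by (simp add: power_int_mult_distrib fls_const_power_int fls_X_power_int)
  have "phi q f = fls_const (of_nat q powi m) * (fps_to_fls (fps_compose (fls_base_factor_to_fps f) (of_nat q * fps_X)) * fls_X_intpow m)"
    by (simp add: phi_def fls_compose_fps_def m_def Xp[unfolded m_def])
  hence "fls_nth (phi q f) n = of_nat q powi m * fls_nth (fps_to_fls (fps_compose (fls_base_factor_to_fps f) (of_nat q * fps_X))) (n - m)"
    by (simp add: fls_times_both_shifted_simp fls_X_intpow_times_conv_shift)
  also have "of_nat q = fps_const (of_nat q :: complex)" by (simp add: fps_of_nat)
  finally have *: "fls_nth (phi q f) n = of_nat q powi m * (if n < m then 0 else of_nat q ^ nat (n - m) * fls_nth f n)"
    by (simp add: fps_nth_compose_linear fls_base_factor_to_fps_nth m_def)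
  show ?thesis
  proof (cases "n < m")
    case True
    thus ?thesis using * by (simp add: m_def)
  next
    case False
    have "(of_nat q :: complex) powi m * of_nat q ^ nat (n - m) = of_nat q powi (m + (n - m))"
      using False q by (subst power_int_add) (auto simp: power_int_def)
    thus ?thesis using * False by simp
  qed
qed

lemma conv_radius_pos_imp_bound:
  fixes c :: "nat \<Rightarrow> complex"
  assumes "conv_radius c > 0"
  shows "\<exists>C R. C \<ge> 0 \<and> R > 0 \<and> (\<forall>n. norm (c n) \<le> C * R ^ n)"
proof -
  obtain r where r: "0 < r" "ereal r < conv_radius c"
    using assms ereal_dense2[of 0 "conv_radius c"] by (metis ereal_less(2) zero_ereal_def)
  have "summable (\<lambda>n. c n * of_real r ^ n)"
    by (rule summable_in_conv_radius) (use r in auto)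
  hence "Bseq (\<lambda>n. c n * of_real r ^ n)"
    using summable_LIMSEQ_zero convergent_imp_Bseq convergentI by blast
  then obtain C where C: "C > 0" "\<And>n. norm (c n * of_real r ^ n) \<le> C" unfolding Bseq_def by blast
  have "norm (c n) \<le> C * (1 / r) ^ n" for n
    using C(2)[of n] r by (simp add: norm_mult norm_power power_divide field_simps)
  thus ?thesis using C(1) r by (intro exI[of _ C] exI[of _ "1 / r"]) auto
qed

lemma bound_imp_conv_radius_pos:
  fixes c :: "nat \<Rightarrow> complex"
  assumes "\<And>n. norm (c n) \<le> C * R ^ n" "R > 0"
  shows "conv_radius c > 0"
proof -
  have "summable (\<lambda>n. c n * of_real (1 / (2 * R)) ^ n)"
  proof (rule summable_comparison_test')
    show "summable (\<lambda>n. C * (1 / 2) ^ n)" by (intro summable_mult summable_geometric) auto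
    show "norm (c n * of_real (1 / (2 * R)) ^ n) \<le> C * (1 / 2) ^ n" if "n \<ge> 0" for n
      using assms(1)[of n] assms(2) by (simp add: norm_mult norm_power norm_divide power_divide power_mult_distrib field_simps)
  qed
  from conv_radius_geI[OF this] have "conv_radius c \<ge> ereal (1 / (2 * R))" using assms(2) by (simp add: norm_divide norm_mult)
  moreover have "ereal (1 / (2 * R)) > 0" using assms(2) by simp
  ultimately show ?thesis by order
qed

text \<open>Comparing coefficients, with \<open>m\<close> the order of \<open>f\<close>, determines
  \<open>u n\<close> from earlier terms with denominator \<open>q ^ m * (q ^ n - 1)\<close>. As
  \<open>q ^ n - 1 \<ge> 1\<close> for \<open>n > 0\<close>, there are no small denominators, and a
  geometric bound for \<open>a\<close> yields one for \<open>f\<close>.\<close>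

lemma phi_solution_converges:
  assumes q: "q \<ge> 2" and f: "f \<noteq> 0" and eq: "phi q f = a * f" and conv: "fls_conv_radius a > 0"
  shows "fls_conv_radius f > 0"
proof -
  define m where "m = fls_subdegree f"
  define u where "u n = fls_nth f (m + int n)" for n
  have nz: "fls_nth f m \<noteq> 0" using f by (simp add: m_def)
  have "phi q f \<noteq> 0"
    using phi_nth[of q f m] nz q by auto
  hence a: "a \<noteq> 0" using eq by auto
  have "fls_subdegree (phi q f) = m"
    by (rule fls_subdegree_eqI) (use q nz in \<open>auto simp: phi_nth m_def\<close>)
  hence sa: "fls_subdegree a = 0" using eq a f by (simp add: m_def)
  have rec: "of_nat q powi (m + int n) * u n = (\<Sum>i\<le>n. fls_nth a (int i) * u (n - i))" for n
  proof -
    have "of_nat q powi (m + int n) * u n = fls_nth (a * f) (m + int n)"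
      using q by (simp add: u_def phi_nth flip: eq)
    also have "\<dots> = (\<Sum>i=0..int n. fls_nth a i * fls_nth f (m + int n - i))"
      by (simp add: fls_times_nth(2) sa m_def)
    also have "\<dots> = (\<Sum>i\<le>n. fls_nth a (int i) * u (n - i))"
      by (rule sum.reindex_bij_witness[of _ int nat]) (auto simp: u_def of_nat_diff algebra_simps)
    finally show ?thesis .
  qed
  have qm: "of_nat q powi m = fls_nth a 0"
    using rec[of 0] nz by (simp add: u_def)
  obtain C R where CR: "C \<ge> 0" "R > 0" "\<And>n. norm (fls_nth a (int n)) \<le> C * R ^ n"
    using conv_radius_pos_imp_bound[of "fps_nth (fls_regpart a)"] conv unfolding fls_conv_radius_def fps_conv_radius_def by auto
  define D where "D = C / norm (of_nat q powi m :: complex)"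
  have qpos: "norm (of_nat q powi m :: complex) > 0" using q by simp
  hence "D \<ge> 0" using CR by (simp add: D_def)
  define B where "B = R * (1 + D)"
  have B: "B > 0" "R \<le> B" using CR \<open>D \<ge> 0\<close> by (auto simp: B_def algebra_simps intro: add_pos_nonneg)
  have step: "norm (u n) \<le> (\<Sum>i\<in>{1..n}. D * R ^ i * norm (u (n - i)))" if "n > 0" for n
  proof -
    have "{..n} = insert 0 {1..n}" by auto
    hence "(of_nat q ^ n - 1) * (of_nat q powi m * u n) = (\<Sum>i\<in>{1..n}. fls_nth a (int i) * u (n - i))"
      using rec[of n] qm q by (simp add: power_int_add algebra_simps)
    hence "norm (of_nat q ^ n - 1 :: complex) * (norm (of_nat q powi m :: complex) * norm (u n)) \<le> (\<Sum>i\<in>{1..n}. norm (fls_nth a (int i) * u (n - i)))"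
      by (metis norm_mult norm_sum)
    also have "\<dots> \<le> (\<Sum>i\<in>{1..n}. C * R ^ i * norm (u (n - i)))"
      by (intro sum_mono) (auto simp: norm_mult intro!: mult_right_mono CR)
    finally have 1: "norm (of_nat q ^ n - 1 :: complex) * (norm (of_nat q powi m :: complex) * norm (u n)) \<le> (\<Sum>i\<in>{1..n}. C * R ^ i * norm (u (n - i)))" .
    have "q ^ 1 \<le> q ^ n" using q that by (intro power_increasing) auto
    hence "2 \<le> q ^ n" using q by simp
    hence "1 \<le> norm (of_nat (q ^ n - 1) :: complex)" by (simp only: norm_of_nat)
    also have "(of_nat (q ^ n - 1) :: complex) = of_nat q ^ n - 1" using \<open>2 \<le> q ^ n\<close> by (simp add: of_nat_diff)
    finally have "1 * (norm (of_nat q powi m :: complex) * norm (u n)) \<le> norm (of_nat q ^ n - 1 :: complex) * (norm (of_nat q powi m :: complex) * norm (u n))"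
      by (intro mult_right_mono) auto
    with 1 have "norm (of_nat q powi m :: complex) * norm (u n) \<le> (\<Sum>i\<in>{1..n}. C * R ^ i * norm (u (n - i)))" by simp
    hence "norm (u n) \<le> (\<Sum>i\<in>{1..n}. C * R ^ i * norm (u (n - i))) / norm (of_nat q powi m :: complex)"
      using qpos by (simp add: field_simps)
    also have "\<dots> = (\<Sum>i\<in>{1..n}. D * R ^ i * norm (u (n - i)))"
      by (simp add: D_def sum_divide_distrib)
    finally show ?thesis .
  qed
  have bound: "norm (u n) \<le> norm (u 0) * B ^ n" for n
  proof (induction n rule: less_induct)
    case (less n)
    show ?case
    proof (cases "n = 0")
      case False
      hence "norm (u n) \<le> (\<Sum>i\<in>{1..n}. D * R ^ i * norm (u (n - i)))" by (intro step) auto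
      also have "\<dots> \<le> (\<Sum>i\<in>{1..n}. D * R ^ i * (norm (u 0) * B ^ (n - i)))"
        using \<open>D \<ge> 0\<close> CR False by (intro sum_mono mult_left_mono less.IH) auto
      also have "\<dots> = norm (u 0) * (\<Sum>i\<in>{1..n}. D * R ^ i * B ^ (n - i))"
        by (simp add: sum_distrib_left mult_ac)
      also have "(\<Sum>i\<in>{1..k}. D * R ^ i * B ^ (k - i)) \<le> B ^ k" for k
      proof -
        \<comment> \<open>Subtracting \<open>R ^ k\<close> strengthens the claim just enough: with
          \<open>B = R * (1 + D)\<close> the new term \<open>D * R ^ Suc k\<close> is absorbed
          exactly.\<close>
        have "(\<Sum>i\<in>{1..k}. D * R ^ i * B ^ (k - i)) \<le> B ^ k - R ^ k"
        proof (induction k)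
          case (Suc k)
          have "(\<Sum>i\<in>{1..Suc k}. D * R ^ i * B ^ (Suc k - i)) = B * (\<Sum>i\<in>{1..k}. D * R ^ i * B ^ (k - i)) + D * R ^ Suc k"
            by (simp add: sum_distrib_left Suc_diff_le mult_ac)
          also have "\<dots> \<le> B * (B ^ k - R ^ k) + D * R ^ Suc k"
            using Suc B by (intro add_right_mono mult_left_mono) auto
          also have "\<dots> = B ^ Suc k - R ^ Suc k" by (simp add: B_def algebra_simps)
          finally show ?case .
        qed auto
        also have "\<dots> \<le> B ^ k" using CR by simp
        finally show ?thesis .
      qed
      finally show ?thesis by (simp add: mult_left_mono)
    qed auto
  qed
  have "fls_conv_radius f = conv_radius u"
    by (simp add: fls_conv_radius_altdef fps_conv_radius_def u_def [abs_def] m_def fls_base_factor_to_fps_nth add.commute)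
  thus ?thesis using bound_imp_conv_radius_pos[OF bound B(1)] by simp
qed

text \<open>Iterating the equation expresses the value at \<open>z\<close> by the value at
  \<open>z / q ^ k\<close> and the product of the \<open>a (z / q ^ i)\<close> for
  \<open>1 \<le> i \<le> k\<close>. This is meromorphic on discs exhausting the plane.\<close>

lemma global_extension:
  assumes q: "q \<ge> 2" and f: "f \<noteq> 0" and eq: "phi q f = A * f"
    and a: "a has_laurent_expansion A" and mero: "a meromorphic_on UNIV"
  shows "\<exists>F. F meromorphic_on UNIV \<and> F has_laurent_expansion f \<and> (\<forall>z. z \<noteq> 0 \<longrightarrow> F (of_nat q * z) = a z * F z)"
proof -
  define Q where "Q = real q"
  have Q: "Q > 1" using q by (simp add: Q_def)
  define g where "g = eval_fls f"
  have rad: "fls_conv_radius f > 0"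
    using phi_solution_converges[OF q f eq] a by (simp add: has_laurent_expansion_def)
  hence g: "g has_laurent_expansion f" unfolding g_def by (rule eval_fls_has_laurent_expansion)
  have X: "(\<lambda>z. of_nat q * z) has_laurent_expansion fps_to_fls (of_nat q * fps_X :: complex fps)"
    unfolding fps_of_nat [symmetric] by (intro has_laurent_expansion_fps fps_expansion_intros)
  have "(g \<circ> (\<lambda>z. of_nat q * z)) has_laurent_expansion phi q f"
    unfolding phi_def by (rule has_laurent_expansion_compose[OF g X]) (use q in auto)
  moreover have "(\<lambda>z. a z * g z) has_laurent_expansion A * f" by (intro laurent_expansion_intros a g)
  ultimately have "(\<lambda>z. (g \<circ> (\<lambda>z. of_nat q * z)) z - a z * g z) has_laurent_expansion phi q f - A * f"
    by (rule has_laurent_expansion_diff)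
  hence "(\<lambda>z. g (of_nat q * z) - a z * g z) has_laurent_expansion 0" by (simp add: eq)
  hence "eventually (\<lambda>z. g (of_nat q * z) = a z * g z) (at 0)" by (simp add: has_laurent_expansion_def)
  then obtain r1 where r1: "r1 > 0" "\<And>z. z \<noteq> 0 \<Longrightarrow> norm z < r1 \<Longrightarrow> g (of_nat q * z) = a z * g z"
    unfolding eventually_at by (auto simp: dist_norm)
  obtain r2 where r2: "r2 > 0" "ereal r2 < fls_conv_radius f"
    using rad ereal_dense2[of 0 "fls_conv_radius f"] by (metis ereal_less(2) zero_ereal_def)
  define r where "r = min r1 (r2 / Q)"
  have r: "r > 0" "r \<le> r1" "Q * r \<le> r2" using r1 r2 Q by (auto simp: r_def min_def field_simps)
  define c where "c = (of_nat q :: complex)"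
  have c: "c \<noteq> 0" "norm c = Q" using q by (auto simp: c_def Q_def)
  define G where "G k z = g (z / c ^ k) * (\<Prod>i\<in>{1..k}. a (z / c ^ i))" for k z
  \<comment> \<open>On \<open>U k\<close> the norm of \<open>z / c ^ k\<close> is below
    \<open>Q * r\<close>, inside the disc of convergence, so \<open>G k\<close> is meromorphic; that
    of \<open>z / c ^ Suc k\<close> is below \<open>r\<close>, so the functional equation gives
    \<open>G (Suc k) z = G k z\<close> off \<open>0\<close>.\<close>
  define U where "U k = ball (0::complex) (Q ^ Suc k * r)" for k
  have U_iff: "z \<in> U k \<longleftrightarrow> norm (z / c ^ Suc k) < r" for z k
    using Q by (simp add: U_def norm_divide norm_mult norm_power c field_simps)
  have G_mero: "G k meromorphic_on U k" for k
    unfolding G_def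
  proof (intro meromorphic_intros)
    have "(\<lambda>z. eval_fls f (z / c ^ k)) meromorphic_on U k"
    proof (rule meromorphic_on_eval_fls)
      show "(\<lambda>z. z / c ^ k) analytic_on U k" by (intro analytic_intros) (use c in auto)
      fix z assume "z \<in> U k"
      hence "norm (z / c ^ k) < Q * r" using Q by (simp add: U_def norm_divide norm_power c field_simps)
      hence "ereal (norm (z / c ^ k)) < ereal r2" using r by simp
      thus "ereal (norm (z / c ^ k)) < fls_conv_radius f" using r2 by order
    qed
    thus "(\<lambda>z. g (z / c ^ k)) meromorphic_on U k" by (simp add: g_def)
    show "(\<lambda>z. a (z / c ^ i)) meromorphic_on U k" for i
      by (rule meromorphic_on_compose[OF mero]) (use c in \<open>auto intro!: analytic_intros\<close>)
  qed
  have G_Suc: "G (Suc k) z = G k z" if "z \<in> U k" "z \<noteq> 0" for k z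
  proof -
    have "g (of_nat q * (z / c ^ Suc k)) = a (z / c ^ Suc k) * g (z / c ^ Suc k)"
      by (rule r1(2)) (use that r c in \<open>auto simp: U_iff\<close>)
    moreover have "of_nat q * (z / c ^ Suc k) = z / c ^ k" using c(1) by (simp add: c_def)
    ultimately show ?thesis by (simp add: G_def)
  qed
  have U_mono: "U k \<subseteq> U l" if "k \<le> l" for k l
    unfolding U_def using Q r that by (intro subset_ball mult_right_mono power_increasing) auto
  have G_eq: "G l z = G k z" if "z \<in> U k" "z \<noteq> 0" "k \<le> l" for k l z
    using that(3)
  proof (induction l rule: dec_induct)
    case (step l)
    thus ?case using G_Suc[of z l] U_mono[of k l] that by auto
  qed auto
  have G_func: "G (Suc k) (of_nat q * z) = a z * G k z" for k z
  proof -
    have "(\<Prod>i\<in>{1..Suc k}. a (of_nat q * z / c ^ i)) = (\<Prod>i\<in>{0..k}. a (of_nat q * z / c ^ Suc i))"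
      by (simp add: prod.shift_bounds_cl_Suc_ivl del: prod.cl_ivl_Suc)
    also have "\<dots> = (\<Prod>i\<in>{0..k}. a (z / c ^ i))"
      using c by (simp add: c_def)
    also have "{0..k} = insert 0 {1..k}" by auto
    finally show ?thesis using c by (simp add: G_def c_def)
  qed
  have ex_U: "\<exists>k. z \<in> U k" for z
  proof -
    obtain k where "norm z / r < Q ^ k" using real_arch_pow[OF Q] by blast
    hence "norm z < Q ^ k * r" using r by (simp add: field_simps)
    also have "\<dots> \<le> Q ^ Suc k * r" using Q r by (intro mult_right_mono power_increasing) auto
    finally show ?thesis by (auto simp: U_def)
  qed
  \<comment> \<open>Away from \<open>0\<close> any admissible index gives the same value, by
    \<open>G_eq\<close>.\<close>
  define F where "F z = G (LEAST k. z \<in> U k) z" for z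
  have F_eq: "F z = G k z" if "z \<in> U k" "z \<noteq> 0" for z k
    unfolding F_def using G_eq[of z "LEAST k. z \<in> U k" k] that by (metis LeastI Least_le)
  have ev: "eventually (\<lambda>w. F w = G k w) (at z)" if "z \<in> U k" for z k
  proof -
    have "eventually (\<lambda>w. w \<in> U k) (at z)" by (rule eventually_at_in_open') (use that in \<open>auto simp: U_def\<close>)
    moreover have "eventually (\<lambda>w. w \<noteq> 0) (at z)"
      by (cases "z = 0") (auto simp: eventually_neq_at_within)
    ultimately show ?thesis by eventually_elim (use F_eq in auto)
  qed
  have "F meromorphic_on {z}" for z
  proof -
    obtain k where k: "z \<in> U k" using ex_U by blast
    have "F meromorphic_on {z} \<longleftrightarrow> G k meromorphic_on {z}"
      by (rule meromorphic_on_cong) (use ev k in auto)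
    thus ?thesis using meromorphic_on_subset[OF G_mero] k by simp
  qed
  hence "F meromorphic_on UNIV" by (subst meromorphic_on_meromorphic_at) auto
  moreover have "F has_laurent_expansion f"
  proof -
    have "F has_laurent_expansion f \<longleftrightarrow> g has_laurent_expansion f"
      using ev[of 0 0] Q r by (intro has_laurent_expansion_cong) (auto simp: U_def G_def)
    thus ?thesis using g by simp
  qed
  moreover have "F (of_nat q * z) = a z * F z" if "z \<noteq> 0" for z
  proof -
    obtain k where k: "z \<in> U k" using ex_U by blast
    have "of_nat q * z \<in> U (Suc k)" using k Q by (simp add: U_def norm_mult Q_def)
    thus ?thesis using F_eq[of "of_nat q * z" "Suc k"] F_eq[of z k] G_func k that q by simp
  qed
  ultimately show ?thesis by blast
qed

section \<open>Translates of a solution\<close>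

locale q_solution =
  fixes L :: "complex set" and q :: nat and a F :: "complex \<Rightarrow> complex"
  assumes lattice: "is_lattice L" and q: "q \<ge> 2"
    and mero: "F meromorphic_on UNIV" and nonzero: "eventually (\<lambda>z. F z \<noteq> 0) (cosparse UNIV)"
    and per: "w \<in> L \<Longrightarrow> a (z + w) = a z"
    and func: "z \<noteq> 0 \<Longrightarrow> F (of_nat q * z) = a z * F z"
begin

text \<open>
  \<open>g j\<close> is the \<open>j\<close>-th derivative of the logarithmic derivative of \<open>F\<close>. The set \<open>Gd\<close> of good points is
  the largest subset of \<open>D\<close> that is stable under translation by \<open>L\<close> and division by \<open>q\<close>.
\<close>

definition D :: "complex set" where "D = {z. z \<noteq> 0 \<and> F analytic_on {z} \<and> F z \<noteq> 0}"

definition g :: "nat \<Rightarrow> complex \<Rightarrow> complex" where "g j = (deriv ^^ j) (\<lambda>z. deriv F z / F z)"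

definition Gd :: "complex set" where "Gd = {z. \<forall>k. \<forall>w\<in>L. (z + w) / of_nat q ^ k \<in> D}"

section \<open>Domains of definition and good points\<close>

lemma q_nz [simp]: "(of_nat q :: complex) \<noteq> 0" "q > 0" "q \<noteq> 0"
  using q by auto

lemma D_nz: "z \<in> D \<Longrightarrow> z \<noteq> 0" "z \<in> D \<Longrightarrow> F z \<noteq> 0"
  by (auto simp: D_def)

lemma F_holo: "F holomorphic_on D"
  by (rule analytic_imp_holomorphic, subst analytic_on_analytic_at) (auto simp: D_def)

lemma open_D: "open D"
proof (rule Topological_Spaces.openI)
  fix z assume z: "z \<in> D"
  then obtain A where A: "open A" "z \<in> A" "F holomorphic_on A" by (auto simp: D_def analytic_at)
  have "open ({w \<in> A. F w \<noteq> 0})"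
    using continuous_open_preimage[of A F "- {0}"] A holomorphic_on_imp_continuous_on[of F A]
    by (auto simp: vimage_def Int_def)
  thus "\<exists>T. open T \<and> z \<in> T \<and> T \<subseteq> D"
    using z A by (intro exI[of _ "{w \<in> A. F w \<noteq> 0} - {0}"]) (auto simp: D_def analytic_at)
qed

lemma countable_D: "countable (- D)"
proof -
  have "eventually (\<lambda>z. F analytic_on {z}) (cosparse UNIV)"
    by (rule meromorphic_on_imp_analytic_cosparse[OF mero])
  with nonzero have "eventually (\<lambda>z. F analytic_on {z} \<and> F z \<noteq> 0) (cosparse UNIV)"
    by eventually_elim auto
  hence "{z. \<not> (F analytic_on {z} \<and> F z \<noteq> 0)} sparse_in UNIV" by (simp add: eventually_cosparse)
  hence "countable (UNIV \<inter> {z. \<not> (F analytic_on {z} \<and> F z \<noteq> 0)})" by (intro sparse_imp_countable) auto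
  moreover have "- D \<subseteq> insert 0 (UNIV \<inter> {z. \<not> (F analytic_on {z} \<and> F z \<noteq> 0)})" by (auto simp: D_def)
  ultimately show ?thesis by (meson countable_insert countable_subset)
qed

definition Dm :: "complex \<Rightarrow> complex set" where "Dm w = {z. z \<in> D \<and> z + w \<in> D}"

lemma Dm_nz: "z \<in> Dm w \<Longrightarrow> F z \<noteq> 0"
  by (simp add: Dm_def D_def)

lemma open_Dm: "open (Dm w)"
proof -
  have "Dm w = D \<inter> (\<lambda>z. z + w) -` D" by (auto simp: Dm_def)
  moreover have "open ((\<lambda>z. z + w) -` D)" by (intro open_vimage open_D continuous_intros)
  ultimately show ?thesis using open_D by auto
qed

lemma countable_Dm: "countable (- Dm w)"
proof -
  have "- Dm w = (- D) \<union> (\<lambda>z. z - w) ` (- D)" by (force simp: Dm_def)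
  thus ?thesis using countable_D by auto
qed

lemma connected_co_countable: "open U \<Longrightarrow> countable (- U) \<Longrightarrow> connected (U :: complex set)"
  using connected_open_diff_countable[of UNIV "- U"] by (auto simp: Compl_eq_Diff_UNIV Diff_Diff_Int)

lemma connected_Dm: "connected (Dm w)"
  by (rule connected_co_countable[OF open_Dm countable_Dm])

text \<open>\<open>L\<close> is countable, so infinitely many conditions still exclude only
  countably many points. This makes \<open>Gd\<close> dense, and identities of continuous functions
  can be checked on it.\<close>

lemma countable_Gd: "countable (- Gd)"
proof -
  have "- Gd \<subseteq> (\<Union>k. \<Union>w\<in>L. (\<lambda>z. of_nat q ^ k * z - w) ` (- D))"
  proof
    fix z assume "z \<in> - Gd"
    then obtain k w where kw: "w \<in> L" "(z + w) / of_nat q ^ k \<in> - D" by (auto simp: Gd_def)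
    have "z = of_nat q ^ k * ((z + w) / of_nat q ^ k) - w" by (simp add: field_simps)
    with kw show "z \<in> (\<Union>k. \<Union>w\<in>L. (\<lambda>z. of_nat q ^ k * z - w) ` (- D))" by blast
  qed
  moreover have "countable (\<Union>k. \<Union>w\<in>L. (\<lambda>z. of_nat q ^ k * z - w) ` (- D))"
    using countable_D lattice_countable[OF lattice] by (intro countable_UN) auto
  ultimately show ?thesis by (rule countable_subset)
qed

lemma Gd_D: "z \<in> Gd \<Longrightarrow> z \<in> D"
  unfolding Gd_def using lattice_0[OF lattice] by (metis (mono_tags, lifting) add.right_neutral div_by_1 mem_Collect_eq power_0)

lemma Gd_add: "z \<in> Gd \<Longrightarrow> w \<in> L \<Longrightarrow> z + w \<in> Gd"
  unfolding Gd_def using lattice_add[OF lattice] by (auto simp: add.assoc)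

lemma Gd_div: "z \<in> Gd \<Longrightarrow> z / of_nat q \<in> Gd"
proof -
  assume z: "z \<in> Gd"
  have "(z / of_nat q + w) / of_nat q ^ k \<in> D" if "w \<in> L" for w k
  proof -
    have "(z + of_nat q * w) / of_nat q ^ Suc k \<in> D"
      using z lattice_of_nat[OF lattice that, of q] unfolding Gd_def by blast
    moreover have "(z + of_nat q * w) / of_nat q ^ Suc k = (z / of_nat q + w) / of_nat q ^ k"
      by (simp add: field_simps)
    ultimately show ?thesis by simp
  qed
  thus ?thesis by (auto simp: Gd_def)
qed

lemma Gd_Dm: "z \<in> Gd \<Longrightarrow> w \<in> L \<Longrightarrow> z \<in> Dm w"
  using Gd_D Gd_add by (auto simp: Dm_def)

lemma Gd_dense:
  assumes "open U" "U \<noteq> {}"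
  shows "\<exists>z\<in>U. z \<in> Gd"
proof (rule ccontr)
  assume "\<not> ?thesis"
  hence "U \<subseteq> - Gd" by auto
  hence "countable U" using countable_Gd countable_subset by blast
  moreover obtain z e where "e > 0" "ball z e \<subseteq> U" using assms open_contains_ball by blast
  ultimately show False using uncountable_ball[of e z] countable_subset by blast
qed

lemma eq_from_Gd:
  assumes "open U" "continuous_on U \<phi>" "continuous_on U \<psi>" "\<And>z. z \<in> U \<Longrightarrow> z \<in> Gd \<Longrightarrow> \<phi> z = \<psi> z" "z \<in> U"
  shows "(\<phi> z :: complex) = \<psi> z"
proof (rule ccontr)
  assume ne: "\<phi> z \<noteq> \<psi> z"
  have "open {w \<in> U. \<phi> w - \<psi> w \<noteq> 0}"
    using continuous_open_preimage[of U "\<lambda>w. \<phi> w - \<psi> w" "- {0}"] assms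
    by (auto intro!: continuous_intros simp: vimage_def Int_def)
  then obtain w where "w \<in> U" "\<phi> w - \<psi> w \<noteq> 0" "w \<in> Gd"
    using Gd_dense[of "{w \<in> U. \<phi> w - \<psi> w \<noteq> 0}"] ne assms(5) by auto
  thus False using assms(4) by auto
qed

section \<open>Logarithmic derivatives and their scaling by \<open>q\<close>\<close>

lemma g_holo: "g j holomorphic_on D"
  unfolding g_def
  by (intro holomorphic_higher_deriv holomorphic_intros F_holo holomorphic_deriv open_D) (auto simp: D_def)

lemma g_deriv: "z \<in> D \<Longrightarrow> (g j has_field_derivative g (Suc j) z) (at z)"
  using holomorphic_derivI[OF g_holo open_D, of z j] by (simp add: g_def)

lemma g_mero: "g j meromorphic_on UNIV"
  unfolding g_def by (intro meromorphic_intros mero)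

lemma F_deriv: "z \<in> D \<Longrightarrow> (F has_field_derivative F z * g 0 z) (at z)"
  using holomorphic_derivI[OF F_holo open_D, of z] by (simp add: g_def D_def)

lemma g_deriv_affine:
  assumes "c * z + d \<in> D"
  shows "((\<lambda>z. g j (c * z + d)) has_field_derivative g (Suc j) (c * z + d) * c) (at z)"
proof -
  have "((\<lambda>z. c * z + d) has_field_derivative c) (at z)" by (auto intro!: derivative_eq_intros)
  from DERIV_chain2[of "g j" _ "\<lambda>z. c * z + d", OF g_deriv[OF assms] this] show ?thesis .
qed

lemma F_deriv_shift:
  assumes "z + d \<in> D"
  shows "((\<lambda>z. F (z + d)) has_field_derivative F (z + d) * g 0 (z + d)) (at z)"
proof -
  have "((\<lambda>z. z + d) has_field_derivative 1) (at z)" by (auto intro!: derivative_eq_intros)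
  from DERIV_chain2[of F _ "\<lambda>z. z + d", OF F_deriv[OF assms] this] show ?thesis by simp
qed

lemma ratio_deriv:
  assumes "z \<in> Dm w"
  shows "((\<lambda>z. F (z + w) / F z) has_field_derivative (F (z + w) / F z * (g 0 (z + w) - g 0 z))) (at z)"
proof -
  have z: "z \<in> D" "z + w \<in> D" "F z \<noteq> 0" using assms by (auto simp: Dm_def D_def)
  show ?thesis
    by (rule DERIV_cong[OF DERIV_divide[OF F_deriv_shift[OF z(2)] F_deriv[OF z(1)] z(3)]])
       (use z in \<open>simp add: field_simps\<close>)
qed

text \<open>By periodicity of \<open>a\<close>, numerator and denominator acquire the same factor
  \<open>a z\<close>.\<close>

lemma ratio_scale:
  assumes "z \<in> Dm w" "of_nat q * z \<in> D" "w \<in> L"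
  shows "F (of_nat q * z + of_nat q * w) / F (of_nat q * z) = F (z + w) / F z"
proof -
  have "F (of_nat q * z + of_nat q * w) = a z * F (z + w)"
    using func[of "z + w"] per[OF assms(3), of z] assms(1) by (auto simp: Dm_def D_def algebra_simps)
  moreover have "F (of_nat q * z) = a z * F z" using func[of z] assms(1) by (auto simp: Dm_def D_def)
  moreover have "F (of_nat q * z) \<noteq> 0" using assms(2) D_nz by auto
  ultimately show ?thesis by auto
qed

definition Dq :: "complex \<Rightarrow> complex set" where
  "Dq w = {z. z \<in> Dm w \<and> of_nat q * z \<in> Dm (of_nat q * w)}"

lemma open_Dq: "open (Dq w)"
proof -
  have "Dq w = Dm w \<inter> (\<lambda>z. of_nat q * z) -` Dm (of_nat q * w)" by (auto simp: Dq_def)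
  moreover have "open ((\<lambda>z. of_nat q * z) -` Dm (of_nat q * w))"
    by (intro open_vimage open_Dm continuous_intros)
  ultimately show ?thesis using open_Dm by auto
qed

text \<open>Logarithmic differentiation of \<open>ratio_scale\<close> gives the case
  \<open>j = 0\<close>; each further derivative contributes one more factor \<open>q\<close> by the
  chain rule.\<close>

lemma g_scale:
  assumes "z \<in> Dq w" "w \<in> L"
  shows "of_nat q ^ Suc j * (g j (of_nat q * z + of_nat q * w) - g j (of_nat q * z)) = g j (z + w) - g j z"
  using assms(1)
proof (induction j arbitrary: z)
  case 0
  let ?c = "of_nat q :: complex"
  have z: "z \<in> Dm w" "?c * z \<in> Dm (?c * w)" using 0 by (auto simp: Dq_def)
  have "((\<lambda>z. F (?c * z + ?c * w) / F (?c * z)) has_field_derivative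
      (F (?c * z + ?c * w) / F (?c * z) * (g 0 (?c * z + ?c * w) - g 0 (?c * z)) * ?c)) (at z)"
    by (rule DERIV_chain2[of "\<lambda>y. F (y + ?c * w) / F y" _ "\<lambda>z. ?c * z", OF ratio_deriv[OF z(2)] DERIV_cmult_Id])
  moreover have "((\<lambda>z. F (?c * z + ?c * w) / F (?c * z)) has_field_derivative (F (z + w) / F z * (g 0 (z + w) - g 0 z))) (at z)"
  proof (rule has_field_derivative_transform_within_open[OF ratio_deriv[OF z(1)] open_Dq 0])
    fix x assume "x \<in> Dq w"
    thus "F (x + w) / F x = F (?c * x + ?c * w) / F (?c * x)"
      using ratio_scale[of x w] assms(2) by (auto simp: Dq_def Dm_def)
  qed
  ultimately have "F (?c * z + ?c * w) / F (?c * z) * (g 0 (?c * z + ?c * w) - g 0 (?c * z)) * ?c = F (z + w) / F z * (g 0 (z + w) - g 0 z)"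
    by (rule DERIV_unique)
  moreover have "F (?c * z + ?c * w) / F (?c * z) = F (z + w) / F z"
    using ratio_scale[of z w] z assms(2) by (auto simp: Dm_def)
  moreover have "F (z + w) / F z \<noteq> 0" using z by (auto simp: Dm_def D_def)
  ultimately have "(g 0 (?c * z + ?c * w) - g 0 (?c * z)) * ?c = g 0 (z + w) - g 0 z"
    by (metis (no_types, lifting) mult.assoc mult_left_cancel)
  thus ?case by (simp add: mult.commute)
next
  case (Suc j)
  let ?c = "of_nat q :: complex"
  have z: "z \<in> D" "z + w \<in> D" "?c * z \<in> D" "?c * z + ?c * w \<in> D" using Suc.prems by (auto simp: Dq_def Dm_def)
  have "((\<lambda>z. ?c ^ Suc j * (g j (?c * z + ?c * w) - g j (?c * z))) has_field_derivative
      ?c ^ Suc j * (g (Suc j) (?c * z + ?c * w) * ?c - g (Suc j) (?c * z) * ?c)) (at z)"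
    using g_deriv_affine[of ?c z "?c * w" j] g_deriv_affine[of ?c z 0 j] z
    by (intro DERIV_cmult DERIV_diff) auto
  moreover have "((\<lambda>z. ?c ^ Suc j * (g j (?c * z + ?c * w) - g j (?c * z))) has_field_derivative g (Suc j) (z + w) - g (Suc j) z) (at z)"
  proof (rule has_field_derivative_transform_within_open[OF _ open_Dq Suc.prems])
    show "((\<lambda>z. g j (z + w) - g j z) has_field_derivative g (Suc j) (z + w) - g (Suc j) z) (at z)"
      using g_deriv_affine[of 1 z w j] g_deriv[of z j] z by (intro DERIV_diff) auto
  qed (use Suc.IH in auto)
  ultimately have "?c ^ Suc j * (g (Suc j) (?c * z + ?c * w) * ?c - g (Suc j) (?c * z) * ?c) = g (Suc j) (z + w) - g (Suc j) z"
    by (rule DERIV_unique)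
  thus ?case by (simp add: algebra_simps)
qed

lemma Gd_Dq: "z \<in> Gd \<Longrightarrow> w \<in> L \<Longrightarrow> z / of_nat q \<in> Dq w"
  using Gd_Dm[of "z / of_nat q" w] Gd_Dm[of z "of_nat q * w"] Gd_div lattice_of_nat[OF lattice, of w q]
  by (auto simp: Dq_def)

text \<open>
  \<open>T w z\<close> compares the jets \<open>J\<close> of \<open>F\<close> at \<open>z + w\<close> and \<open>z\<close>, with the scaling by \<open>z ^ j\<close> that makes it
  invariant under \<open>(w, z) \<mapsto> (q w, q z)\<close>.
\<close>

definition T :: "complex \<Rightarrow> complex \<Rightarrow> nat \<Rightarrow> complex" where
  "T w z j = (if j = 0 then F (z + w) / F z else z ^ j * (g (j - 1) (z + w) - g (j - 1) z))"

definition J :: "complex \<Rightarrow> nat \<Rightarrow> complex" where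
  "J z j = (if j = 0 then F z else g (j - 1) z)"

lemma T_scale: "z \<in> Gd \<Longrightarrow> w \<in> L \<Longrightarrow> T (of_nat q * w) z = T w (z / of_nat q)"
proof (rule ext)
  fix j assume *: "z \<in> Gd" "w \<in> L"
  define y where "y = z / of_nat q"
  have zy: "z = of_nat q * y" by (simp add: y_def)
  have y: "y \<in> Dq w" unfolding y_def by (rule Gd_Dq[OF *])
  show "T (of_nat q * w) z j = T w y j"
  proof (cases j)
    case 0
    thus ?thesis using ratio_scale[of y w] y * by (auto simp: T_def zy Dq_def Dm_def)
  next
    case (Suc i)
    thus ?thesis using g_scale[OF y *(2), of i] by (simp add: T_def zy power_mult_distrib mult_ac)
  qed
qed

lemma T_scale_pow: "z \<in> Gd \<Longrightarrow> w \<in> L \<Longrightarrow> T (of_nat q ^ k * w) z = T w (z / of_nat q ^ k)"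
proof (induction k arbitrary: z)
  case (Suc k)
  have "T (of_nat q * (of_nat q ^ k * w)) z = T (of_nat q ^ k * w) (z / of_nat q)"
    using Suc.prems lattice_of_nat[OF lattice, of w "q ^ k"] by (intro T_scale) auto
  thus ?case using Suc.IH[of "z / of_nat q"] Suc.prems Gd_div by (simp add: mult.assoc)
qed auto

text \<open>The affine map depends on \<open>z\<close> but not on \<open>w\<close>. A polynomial
  relation among the jets at all translates of \<open>z\<close> thus becomes one among the vectors
  \<open>T w z\<close>.\<close>

lemma J_eq: "z \<in> D \<Longrightarrow> J (z + w) = aff (F z) (\<lambda>j. g (j - 1) z) (1 / z) (T w z)"
  by (auto simp: J_def aff_def T_def D_def fun_eq_iff power_divide)

lemma T_mero: "(\<lambda>z. T w z j) meromorphic_on UNIV"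
proof -
  have *: "(\<lambda>z. f (z + w)) meromorphic_on UNIV" if "f meromorphic_on UNIV" for f
    by (rule meromorphic_on_compose[OF that]) (auto intro!: analytic_intros)
  show ?thesis unfolding T_def by (cases "j = 0") (auto intro!: meromorphic_intros mero g_mero *)
qed

lemma T_cont: "continuous_on (Dm w) (\<lambda>z. T w z j)"
proof -
  have F: "continuous_on D F" using F_holo holomorphic_on_imp_continuous_on by blast
  have g: "continuous_on D (g j)" for j using g_holo holomorphic_on_imp_continuous_on by blast
  have *: "continuous_on (Dm w) (\<lambda>z. f (z + w))" "continuous_on (Dm w) f" if "continuous_on D f" for f
    by (rule continuous_on_compose2[OF that]; auto intro!: continuous_intros simp: Dm_def)+
  show ?thesis unfolding T_def
    using *[OF F] *[OF g[of "j - 1"]]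
    by (cases "j = 0") (auto intro!: continuous_intros dest: Dm_nz)
qed

lemma ev_mero: "(\<And>i. (\<lambda>z. v z i) meromorphic_on A) \<Longrightarrow> (\<lambda>z. ev P (v z)) meromorphic_on A"
proof -
  assume *: "\<And>i. (\<lambda>z. v z i) meromorphic_on A"
  have "(\<lambda>z. mon M (v z)) meromorphic_on A" for M
    by (induction M) (auto intro!: meromorphic_intros *)
  thus ?thesis unfolding ev_def by (intro meromorphic_intros)
qed

lemma ev_cont: "(\<And>i. continuous_on A (\<lambda>z. v z i)) \<Longrightarrow> continuous_on A (\<lambda>z. ev P (v z))"
proof -
  assume *: "\<And>i. continuous_on A (\<lambda>z. v z i)"
  have "continuous_on A (\<lambda>z. mon M (v z))" for M
    by (induction M) (auto intro!: continuous_intros *)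
  thus ?thesis unfolding ev_def by (intro continuous_intros)
qed

text \<open>
  The translates by \<open>q ^ k * w\<close> only give information on \<open>T w\<close> at the points \<open>\<tau> / q ^ k\<close>, but these
  accumulate at \<open>0\<close>, where \<open>T w\<close> is still meromorphic.
\<close>

lemma polynomial_relation_spreads:
  assumes \<tau>: "\<tau> \<in> Gd" and P: "\<And>w. w \<in> L \<Longrightarrow> ev P (J (\<tau> + w)) = 0" and w: "w \<in> L" and \<sigma>: "\<sigma> \<in> Gd"
  shows "ev P (aff (F \<tau>) (\<lambda>j. g (j - 1) \<tau>) (1 / \<tau>) (T w \<sigma>)) = 0"
proof -
  define \<phi> where "\<phi> z = ev P (aff (F \<tau>) (\<lambda>j. g (j - 1) \<tau>) (1 / \<tau>) (T w z))" for z
  have mero: "\<phi> meromorphic_on UNIV"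
    unfolding \<phi>_def
  proof (rule ev_mero)
    show "(\<lambda>z. aff (F \<tau>) (\<lambda>j. g (j - 1) \<tau>) (1 / \<tau>) (T w z) i) meromorphic_on UNIV" for i
      by (cases "i = 0") (auto simp: aff_def intro!: meromorphic_intros T_mero)
  qed
  have cont: "continuous_on (Dm w) \<phi>"
    unfolding \<phi>_def
  proof (rule ev_cont)
    show "continuous_on (Dm w) (\<lambda>z. aff (F \<tau>) (\<lambda>j. g (j - 1) \<tau>) (1 / \<tau>) (T w z) i)" for i
      by (cases "i = 0") (auto simp: aff_def intro!: continuous_intros T_cont)
  qed
  \<comment> \<open>By \<open>T_scale_pow\<close>, translating \<open>\<tau>\<close> by
    \<open>q ^ k * w\<close> amounts to translating \<open>\<tau> / q ^ k\<close> by
    \<open>w\<close>.\<close>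
  have zero: "\<phi> (\<tau> / of_nat q ^ k) = 0" for k
  proof -
    have "ev P (J (\<tau> + of_nat q ^ k * w)) = 0"
      using P[of "of_nat q ^ k * w"] lattice_of_nat[OF lattice w, of "q ^ k"] by simp
    thus ?thesis using J_eq[OF Gd_D[OF \<tau>], of "of_nat q ^ k * w"] T_scale_pow[OF \<tau> w, of k] by (simp add: \<phi>_def)
  qed
  have "\<not> eventually (\<lambda>z. \<phi> z \<noteq> 0) (cosparse UNIV)"
  proof
    assume "eventually (\<lambda>z. \<phi> z \<noteq> 0) (cosparse UNIV)"
    hence ev: "eventually (\<lambda>z. \<phi> z \<noteq> 0) (at 0)" by (rule eventually_cosparse_imp_eventually_at) auto
    have "(\<lambda>k. (1 / of_nat q :: complex) ^ k) \<longlonglongrightarrow> 0"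
      by (rule LIMSEQ_power_zero) (use q in \<open>auto simp: norm_divide\<close>)
    hence "(\<lambda>k. \<tau> * (1 / of_nat q) ^ k) \<longlonglongrightarrow> 0" by (rule tendsto_mult_right_zero)
    hence "(\<lambda>k. \<tau> / of_nat q ^ k) \<longlonglongrightarrow> 0" by (simp add: power_divide)
    moreover have "\<tau> \<noteq> 0" using \<tau> Gd_D D_nz by blast
    ultimately have "filterlim (\<lambda>k. \<tau> / of_nat q ^ k) (at 0) sequentially" by (auto simp: filterlim_at)
    from eventually_compose_filterlim[OF ev this] zero have "eventually (\<lambda>_::nat. False) sequentially" by simp
    thus False by simp
  qed
  with meromorphic_imp_constant_or_avoid[OF mero, of 0] have "eventually (\<lambda>z. \<phi> z = 0) (cosparse UNIV)" by auto
  \<comment> \<open>The identity theorem gives vanishing only on a punctured neighbourhood;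
    continuity at the good point \<open>\<sigma>\<close> supplies the value there.\<close>
  hence "eventually (\<lambda>z. \<phi> z = 0) (at \<sigma>)" by (rule eventually_cosparse_imp_eventually_at) auto
  hence "\<phi> \<midarrow>\<sigma>\<rightarrow> 0" using tendsto_eventually by blast
  moreover have "isCont \<phi> \<sigma>" using cont open_Dm Gd_Dm[OF \<sigma> w] continuous_on_eq_continuous_at by blast
  ultimately have "\<phi> \<sigma> = 0" using isContD LIM_unique by blast
  thus ?thesis by (simp add: \<phi>_def)
qed

text \<open>The vectors \<open>T w z\<close> fit \<open>affine_semigroup\<close>, with changes of
  base point from \<open>z\<close> to \<open>z + v\<close> as the maps. The second alternative of
  \<open>dichotomy\<close> is the claim; the first makes a fixed power of
  \<open>F (z + w) / F z\<close> equal to \<open>1\<close>, so its derivative vanishes and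
  \<open>j = 1\<close>, \<open>c = 0\<close> work.\<close>

lemma linear_relation:
  assumes \<tau>: "\<tau> \<in> Gd" and P: "P \<noteq> 0" "\<And>w. w \<in> L \<Longrightarrow> ev P (J (\<tau> + w)) = 0"
  shows "\<exists>j>0. \<exists>c. \<forall>w\<in>L. \<forall>z\<in>Gd. T w z j = c * (1 - (z / (z + w)) ^ j)"
proof -
  define S where "S = L \<times> Gd"
  define h where "h s = F (snd s + fst s) / F (snd s)" for s
  define \<rho> where "\<rho> s = snd s / (snd s + fst s)" for s :: "complex \<times> complex"
  define t where "t s j = T (fst s) (snd s) j" for s j
  define X where "X = (\<lambda>s. T (fst s) (snd s)) ` S"
  have D: "z \<noteq> 0 \<and> F z \<noteq> 0 \<and> z + w \<noteq> 0 \<and> F (z + w) \<noteq> 0" if "(w, z) \<in> S" for w z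
    using that Gd_Dm[of z w] D_nz by (auto simp: S_def Dm_def)
  interpret AS: affine_semigroup S h \<rho> t X
  proof
    fix s assume "s \<in> S"
    thus "h s \<noteq> 0" "\<rho> s \<noteq> 0" using D[of "fst s" "snd s"] by (auto simp: h_def \<rho>_def)
  next
    have "T 0 \<tau> \<in> X" using \<tau> lattice_0[OF lattice] unfolding X_def S_def by (intro image_eqI[of _ _ "(0, \<tau>)"]) auto
    moreover have "T 0 \<tau> 0 = 1" using \<tau> Gd_D D_nz by (auto simp: T_def)
    ultimately show "\<exists>x\<in>X. x 0 \<noteq> 0" by (intro bexI[of _ "T 0 \<tau>"]) simp_all
  next
    fix P s x
    assume P: "\<And>x. x \<in> X \<Longrightarrow> ev P x = 0" and s: "s \<in> S" and x: "x \<in> X"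
    obtain v z where vz: "s = (v, z)" "v \<in> L" "z \<in> Gd" using s by (auto simp: S_def)
    obtain w \<sigma> where ws: "x = T w \<sigma>" "w \<in> L" "\<sigma> \<in> Gd" using x by (auto simp: S_def X_def)
    have nz: "z \<noteq> 0" "F z \<noteq> 0" "z + v \<noteq> 0" "F (z + v) \<noteq> 0" using D[of v z] s vz by auto
    \<comment> \<open>\<open>inv\<close> recovers \<open>T u z\<close> from the jet at
      \<open>z + u\<close>. Hence \<open>Q\<close>, which is \<open>P\<close> composed with
      \<open>inv\<close>, vanishes on the jets at all translates of \<open>z + v\<close>, and the
      spreading lemma applies with base point \<open>z + v\<close>.\<close>
    define inv where "inv = aff (1 / F z) (\<lambda>j. - (z ^ j) * g (j - 1) z) z"
    have "\<exists>Q. \<forall>y. ev Q y = ev P (inv y)"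
      using ev_aff[of P "\<Sum>M\<in>Poly_Mapping.keys P. \<Sum>\<^sub># M" "1 / F z" "\<lambda>j. - (z ^ j) * g (j - 1) z" z]
      unfolding inv_def by (metis finite_keys member_le_sum zero_le)
    then obtain Q where Q: "\<And>y. ev Q y = ev P (inv y)" by blast
    have inv_J: "inv (J (z + u)) = T u z" for u
      using nz by (auto simp: inv_def aff_def J_def T_def fun_eq_iff algebra_simps)
    have "ev Q (aff (F (z + v)) (\<lambda>j. g (j - 1) (z + v)) (1 / (z + v)) (T w \<sigma>)) = 0"
    proof (rule polynomial_relation_spreads)
      show "z + v \<in> Gd" by (rule Gd_add[OF vz(3,2)])
      show "ev Q (J (z + v + u)) = 0" if "u \<in> L" for u
      proof -
        have "T (v + u) z \<in> X" using that vz lattice_add[OF lattice] unfolding X_def S_def by (intro image_eqI[of _ _ "(v + u, z)"]) auto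
        thus ?thesis using P inv_J[of "v + u"] by (simp add: Q add.assoc)
      qed
    qed (use ws in auto)
    \<comment> \<open>Passing to jets at \<open>z + v\<close> and back at \<open>z\<close> composes
      to the affine map with data \<open>h s\<close>, \<open>t s\<close>, \<open>\<rho> s\<close>;
      this dictates their definitions.\<close>
    also have "inv (aff (F (z + v)) (\<lambda>j. g (j - 1) (z + v)) (1 / (z + v)) (T w \<sigma>)) = aff (h s) (t s) (\<rho> s) x"
      using nz by (auto simp: inv_def aff_def T_def h_def t_def \<rho>_def vz ws fun_eq_iff power_divide field_simps)
    hence "ev Q (aff (F (z + v)) (\<lambda>j. g (j - 1) (z + v)) (1 / (z + v)) (T w \<sigma>)) = ev P (aff (h s) (t s) (\<rho> s) x)" by (simp add: Q)
    ultimately show "ev P (aff (h s) (t s) (\<rho> s) x) = 0" by simp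
  qed
  have "\<exists>Q. AS.vanishing Q \<and> Q \<noteq> 0"
  proof -
    obtain v where v: "\<forall>i. v i \<noteq> 0" "ev P v \<noteq> 0" using ev_nonzero[OF P(1)] by blast
    define A where "A = aff (F \<tau>) (\<lambda>j. g (j - 1) \<tau>) (1 / \<tau>)"
    obtain Q where Q: "\<And>y. ev Q y = ev P (A y)"
      using ev_aff[of P "\<Sum>M\<in>Poly_Mapping.keys P. \<Sum>\<^sub># M" "F \<tau>" "\<lambda>j. g (j - 1) \<tau>" "1 / \<tau>"]
      unfolding A_def by (metis finite_keys member_le_sum zero_le)
    have nz: "\<tau> \<noteq> 0" "F \<tau> \<noteq> 0" using Gd_D[OF \<tau>] D_nz by auto
    have "A (\<lambda>i. if i = 0 then v 0 / F \<tau> else (v i - g (i - 1) \<tau>) * \<tau> ^ i) = v"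
      using nz by (auto simp: A_def aff_def fun_eq_iff power_divide)
    hence "Q \<noteq> 0" using v(2) Q by (metis ev_0)
    moreover have "AS.vanishing Q"
      using polynomial_relation_spreads[OF \<tau> P(2)] unfolding AS.vanishing_def by (auto simp: Q A_def X_def S_def)
    ultimately show ?thesis by blast
  qed
  then obtain Q where Q: "AS.vanishing Q" "Q \<noteq> 0" by blast
  \<comment> \<open>A good point of norm below half that of a nonzero period gives
    \<open>\<rho>\<close> of norm less than \<open>1\<close>.\<close>
  have root: "\<exists>s\<in>S. \<forall>n>0. \<rho> s ^ n \<noteq> 1"
  proof -
    obtain w where w: "w \<in> L" "w \<noteq> 0" using lattice_nonzero[OF lattice] by blast
    obtain z where z: "z \<in> ball 0 (norm w / 2)" "z \<in> Gd" using Gd_dense[of "ball 0 (norm w / 2)"] w by auto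
    have "norm w \<le> norm (z + w) + norm z" by (metis add_diff_cancel_left' norm_triangle_ineq4)
    hence "norm z < norm (z + w)" using z by simp
    hence *: "norm (\<rho> (w, z)) < 1" by (auto simp: \<rho>_def norm_divide divide_less_eq)
    have "\<rho> (w, z) ^ n \<noteq> 1" if "n > 0" for n
    proof
      assume "\<rho> (w, z) ^ n = 1"
      hence "norm (\<rho> (w, z)) ^ n = 1" by (metis norm_one norm_power)
      moreover have "norm (\<rho> (w, z)) ^ n < 1" using * that by (simp add: power_less_one_iff)
      ultimately show False by simp
    qed
    thus ?thesis using w z by (intro bexI[of _ "(w, z)"]) (auto simp: S_def)
  qed
  from AS.dichotomy[OF Q root] show ?thesis
  proof
    assume "\<exists>j>0. \<exists>c. \<forall>s\<in>S. t s j = c * (1 - \<rho> s ^ j)"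
    thus ?thesis by (fastforce simp: S_def t_def \<rho>_def)
  next
    assume "\<exists>m>0. \<forall>s\<in>S. h s ^ m = 1"
    then obtain m where m: "m > 0" "\<And>w z. w \<in> L \<Longrightarrow> z \<in> Gd \<Longrightarrow> (F (z + w) / F z) ^ m = 1" by (auto simp: S_def h_def)
    have "T w z 1 = 0" if w: "w \<in> L" and z: "z \<in> Gd" for w z
    proof -
      let ?r = "\<lambda>z. F (z + w) / F z"
      have zD: "z \<in> Dm w" by (rule Gd_Dm[OF z w])
      have "continuous_on (Dm w) (\<lambda>z. T w z 0 ^ m)" by (intro continuous_intros T_cont)
      hence "?r y ^ m = 1" if "y \<in> Dm w" for y
        using eq_from_Gd[OF open_Dm, of w "\<lambda>z. T w z 0 ^ m" "\<lambda>_. 1" y] m(2)[OF w] that by (simp add: T_def)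
      hence "((\<lambda>z. ?r z ^ m) has_field_derivative 0) (at z)"
        by (intro has_field_derivative_transform_within_open[OF DERIV_const open_Dm zD]) auto
      moreover have "((\<lambda>z. ?r z ^ m) has_field_derivative of_nat m * ?r z ^ (m - 1) * (?r z * (g 0 (z + w) - g 0 z))) (at z)"
        using DERIV_power[OF ratio_deriv[OF zD], of m] by (simp add: mult_ac)
      ultimately have "of_nat m * ?r z ^ (m - 1) * (?r z * (g 0 (z + w) - g 0 z)) = 0" by (rule DERIV_unique[symmetric])
      thus ?thesis using m(1) zD D_nz by (auto simp: T_def Dm_def)
    qed
    thus ?thesis by (intro exI[of _ "1::nat"] conjI exI[of _ 0]) auto
  qed
qed

end

section \<open>Periodicity of the logarithmic derivative\<close>

text \<open>Near \<open>z0\<close> the function is \<open>(w - z0) powi n\<close> times a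
  holomorphic \<open>P\<close> without zeros. The logarithmic derivative of \<open>P\<close> is
  bounded there, so only \<open>n / (w - z0)\<close> contributes.\<close>

lemma log_deriv_limit:
  assumes "f meromorphic_on {z0}" "eventually (\<lambda>z. f z \<noteq> 0) (at z0)"
  shows "(\<lambda>w. (w - z0) * (deriv f w / f w)) \<midarrow>z0\<rightarrow> of_int (zorder f z0)"
proof -
  define n where "n = zorder f z0"
  define P where "P = zor_poly f z0"
  have "frequently (\<lambda>z. f z \<noteq> 0) (at z0)" using assms(2) by (intro eventually_frequently) auto
  with assms(1) obtain r where r: "P z0 \<noteq> 0" "r > 0" "P holomorphic_on cball z0 r"
    "\<And>w. w \<in> cball z0 r - {z0} \<Longrightarrow> f w = P w * (w - z0) powi n \<and> P w \<noteq> 0"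
    using zorder_exist[of f z0] unfolding n_def P_def meromorphic_at_iff by auto
  have P: "P holomorphic_on ball z0 r" using r(3) by (rule holomorphic_on_subset) auto
  have eq: "(w - z0) * (deriv f w / f w) = (w - z0) * deriv P w / P w + of_int n" if w: "w \<in> ball z0 r - {z0}" for w
  proof -
    have nz: "w - z0 \<noteq> 0" "P w \<noteq> 0" "f w = P w * (w - z0) powi n" using w r(4)[of w] by auto
    have dP: "(P has_field_derivative deriv P w) (at w)" using holomorphic_derivI[OF P] w by auto
    have "((\<lambda>w. P w * (w - z0) powi n) has_field_derivative
        deriv P w * (w - z0) powi n + P w * (of_int n * (w - z0) powi (n - 1))) (at w)"
      by (rule DERIV_cong[OF DERIV_mult[OF dP DERIV_power_int[OF DERIV_diff[OF DERIV_ident DERIV_const]]]])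
         (use nz in \<open>auto simp: algebra_simps\<close>)
    hence "(f has_field_derivative deriv P w * (w - z0) powi n + P w * (of_int n * (w - z0) powi (n - 1))) (at w)"
      by (rule has_field_derivative_transform_within_open[of _ _ _ "ball z0 r - {z0}"]) (use w r(4) in \<open>auto simp: open_delete\<close>)
    hence "deriv f w = deriv P w * (w - z0) powi n + P w * (of_int n * (w - z0) powi (n - 1))" by (rule DERIV_imp_deriv)
    moreover define u where "u = w - z0"
    ultimately have "deriv f w = deriv P w * u powi n + P w * (of_int n * (u powi n / u))" "u \<noteq> 0" "u powi n \<noteq> 0" "f w = P w * u powi n"
      using nz by (auto simp: power_int_diff)
    thus ?thesis using nz(2) unfolding u_def [symmetric] by (simp add: field_simps)
  qed
  have "isCont P z0" "isCont (deriv P) z0"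
    using P r(2) by (auto intro!: continuous_on_interior[of "ball z0 r"] holomorphic_on_imp_continuous_on holomorphic_deriv)
  hence "(\<lambda>w. (w - z0) * deriv P w / P w + of_int n) \<midarrow>z0\<rightarrow> (z0 - z0) * deriv P z0 / P z0 + of_int n"
    using r(1) by (intro tendsto_intros) (auto simp: isCont_def)
  also have "?this \<longleftrightarrow> (\<lambda>w. (w - z0) * (deriv f w / f w)) \<midarrow>z0\<rightarrow> (z0 - z0) * deriv P z0 / P z0 + of_int n"
  proof (rule filterlim_cong[OF refl refl])
    have "eventually (\<lambda>w. w \<in> ball z0 r - {z0}) (at z0)" using r by (intro eventually_at_in_open) auto
    thus "eventually (\<lambda>w. (w - z0) * deriv P w / P w + of_int n = (w - z0) * (deriv f w / f w)) (at z0)"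
      by eventually_elim (use eq in auto)
  qed
  finally show ?thesis by (simp add: n_def)
qed

context q_solution begin

lemma ev_D: "eventually (\<lambda>z. z \<in> D) (at x)"
proof -
  have "eventually (\<lambda>z. F analytic_on {z}) (cosparse UNIV)"
    by (rule meromorphic_on_imp_analytic_cosparse[OF mero])
  with nonzero have "eventually (\<lambda>z. F analytic_on {z} \<and> F z \<noteq> 0) (cosparse UNIV)"
    by eventually_elim auto
  hence "eventually (\<lambda>z. F analytic_on {z} \<and> F z \<noteq> 0) (at x)" by (rule eventually_cosparse_imp_eventually_at) auto
  moreover have "eventually (\<lambda>z. z \<noteq> 0) (at x)"
    by (cases "x = 0") (auto simp: eventually_neq_at_within)
  ultimately show ?thesis by eventually_elim (auto simp: D_def)
qed

lemma filterlim_shift: "filterlim (\<lambda>z. z + w) (at (x + w)) (at (x :: complex))"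
  by (auto simp: filterlim_at eventually_neq_at_within intro!: tendsto_intros)

lemma ev_Dm: "eventually (\<lambda>z. z \<in> Dm w) (at x)"
  using ev_D[of x] eventually_compose_filterlim[OF ev_D filterlim_shift[of w x]]
  by eventually_elim (auto simp: Dm_def)

text \<open>\<open>Dm w\<close> is connected because its complement is countable.\<close>

lemma const_on_Dm:
  assumes "\<And>z. z \<in> Dm w \<Longrightarrow> (f has_field_derivative 0) (at z)"
  shows "\<exists>c. \<forall>z\<in>Dm w. f z = c"
  using has_derivative_zero_unique_connected[OF open_Dm connected_Dm, of w f] assms
  unfolding has_field_derivative_def by (metis (no_types, lifting) ext lambda_zero)

text \<open>
  The difference \<open>H (z + w) - H z\<close> is a constant \<open>C w\<close>, additive in \<open>w\<close>; the functional equation turns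
  \<open>C (q w) = q * C w\<close> into \<open>q ^ (i + 2) * C w = C w\<close>.
\<close>

lemma periodic_from_deriv:
  assumes dH: "\<And>z. z \<in> D \<Longrightarrow> (H has_field_derivative H' z) (at z)"
    and per: "\<And>w z. w \<in> L \<Longrightarrow> z \<in> Dm w \<Longrightarrow> H' (z + w) = H' z"
    and scale: "\<And>w z. w \<in> L \<Longrightarrow> z \<in> Dq w \<Longrightarrow> of_nat q ^ Suc i * (H (of_nat q * z + of_nat q * w) - H (of_nat q * z)) = H (z + w) - H z"
    and w: "w \<in> L" and z: "z \<in> Dm w"
  shows "H (z + w) = H z"
proof -
  have "\<exists>c. \<forall>z\<in>Dm v. H (z + v) - H z = c" if v: "v \<in> L" for v
  proof (rule const_on_Dm)
    fix z assume z: "z \<in> Dm v"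
    have "((\<lambda>z. z + v) has_field_derivative 1) (at z)" by (auto intro!: derivative_eq_intros)
    from DERIV_chain2[of H _ "\<lambda>z. z + v", OF dH this] z
    have "((\<lambda>z. H (z + v)) has_field_derivative H' (z + v)) (at z)" by (auto simp: Dm_def)
    from DERIV_diff[OF this dH] z per[OF v z]
    show "((\<lambda>z. H (z + v) - H z) has_field_derivative 0) (at z)" by (auto simp: Dm_def)
  qed
  then obtain C where C: "\<And>v z. v \<in> L \<Longrightarrow> z \<in> Dm v \<Longrightarrow> H (z + v) - H z = C v" by metis
  obtain y where y: "y \<in> Gd" using Gd_dense[of UNIV] by auto
  have qw: "of_nat q * w \<in> L" using lattice_of_nat[OF lattice w] .
  have "H (y + of_nat n * w) - H y = of_nat n * C w" for n
  proof (induction n)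
    case (Suc n)
    have "y + of_nat n * w \<in> Dm w" by (intro Gd_Dm Gd_add y w lattice_of_nat lattice)
    from C[OF w this] Suc show ?case by (simp add: algebra_simps)
  qed auto
  from this[of q] have 1: "C (of_nat q * w) = of_nat q * C w" using C[OF qw Gd_Dm[OF y qw]] by simp
  have "y / of_nat q \<in> Dq w" by (rule Gd_Dq[OF y w])
  hence "of_nat q ^ Suc i * C (of_nat q * w) = C w"
    using scale[OF w, of "y / of_nat q"] C[OF w, of "y / of_nat q"] C[OF qw Gd_Dm[OF y qw]] by (auto simp: Dq_def)
  hence "(of_nat (q ^ Suc (Suc i)) - 1) * C w = 0" using 1 by (simp add: algebra_simps)
  moreover have "q ^ Suc (Suc i) \<noteq> 1" using q by (metis One_nat_def Suc_1 nat.distinct(1) nat_power_eq_Suc_0_iff not_less_eq_eq order_refl)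
  hence "of_nat (q ^ Suc (Suc i)) \<noteq> (1 :: complex)" by (metis of_nat_1_eq_iff)
  ultimately have "C w = 0" by auto
  thus ?thesis using C[OF w z] by simp
qed

text \<open>Dividing the relation by \<open>z ^ j\<close> says that
  \<open>g (j - 1) z + c / z ^ j\<close> is periodic. Up to the normalisation of the constant this
  is a derivative of \<open>F' / F + \<kappa> / z\<close>, and periodicity descends one derivative
  at a time.\<close>

lemma log_deriv_periodic:
  assumes "j > 0" "\<And>w z. w \<in> L \<Longrightarrow> z \<in> Gd \<Longrightarrow> T w z j = c * (1 - (z / (z + w)) ^ j)"
  shows "\<exists>\<kappa>. \<forall>w\<in>L. \<forall>z\<in>Dm w. g 0 (z + w) + \<kappa> / (z + w) = g 0 z + \<kappa> / z"
proof -
  obtain m where j: "j = Suc m" using assms(1) by (cases j) auto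
  \<comment> \<open>\<open>H i\<close> below is the \<open>i\<close>-th derivative of
    \<open>F' / F + \<kappa> / z\<close>; this \<open>\<kappa>\<close> makes the correction term of
    \<open>H m\<close> equal to \<open>c / z ^ j\<close>.\<close>
  define \<kappa> where "\<kappa> = c / ((-1) ^ m * fact m)"
  define H where "H i z = g i z + \<kappa> * (-1) ^ i * fact i / z ^ Suc i" for i z
  have dH: "(H i has_field_derivative H (Suc i) z) (at z)" if z: "z \<in> D" for i z
  proof -
    have z0: "z \<noteq> 0" using z D_nz by blast
    have "((\<lambda>z. \<kappa> * (-1) ^ i * fact i / z ^ Suc i) has_field_derivative \<kappa> * (-1) ^ Suc i * fact (Suc i) / z ^ Suc (Suc i)) (at z)"
    proof -
      have "((\<lambda>z. z ^ Suc i) has_field_derivative of_nat (Suc i) * z ^ i) (at z)"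
        using DERIV_power[OF DERIV_ident, of "Suc i" z] by simp
      from DERIV_divide[OF DERIV_const[of "\<kappa> * (-1) ^ i * fact i"] this] z0
      have "((\<lambda>z. \<kappa> * (-1) ^ i * fact i / z ^ Suc i) has_field_derivative
        (0 * z ^ Suc i - \<kappa> * (-1) ^ i * fact i * (of_nat (Suc i) * z ^ i)) / (z ^ Suc i * z ^ Suc i)) (at z)" by simp
      thus ?thesis by (rule DERIV_cong) (use z0 in \<open>simp add: field_simps\<close>)
    qed
    from DERIV_add[OF g_deriv[OF z, of i] this] show ?thesis by (simp add: H_def [abs_def])
  qed
  have scale: "of_nat q ^ Suc i * (H i (of_nat q * z + of_nat q * w) - H i (of_nat q * z)) = H i (z + w) - H i z"
    if w: "w \<in> L" and z: "z \<in> Dq w" for w z i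
  proof -
    define b where "b = \<kappa> * (-1) ^ i * fact i"
    have "of_nat q ^ Suc i * (b / (of_nat q * z + of_nat q * w) ^ Suc i) = b / (z + w) ^ Suc i"
      "of_nat q ^ Suc i * (b / (of_nat q * z) ^ Suc i) = b / z ^ Suc i"
      unfolding distrib_left[symmetric] power_mult_distrib by simp_all
    thus ?thesis using g_scale[OF z w, of i] unfolding H_def b_def[symmetric] by (simp add: ring_distribs)
  qed
  have "\<forall>w\<in>L. \<forall>z\<in>Dm w. H i (z + w) = H i z" if "i \<le> m" for i
    using that
  proof (induction i rule: inc_induct)
    case base
    show ?case
    proof (intro ballI)
      fix w z assume w: "w \<in> L" and z: "z \<in> Dm w"
      have cont: "continuous_on D (H m)" using dH
        by (meson DERIV_isCont continuous_at_imp_continuous_on)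
      have "continuous_on (Dm w) (\<lambda>z. H m (z + w))" "continuous_on (Dm w) (H m)"
        by (rule continuous_on_compose2[OF cont]; auto intro!: continuous_intros simp: Dm_def)+
      thus "H m (z + w) = H m z"
      proof (rule eq_from_Gd[OF open_Dm _ _ _ z])
        fix z assume z: "z \<in> Dm w" "z \<in> Gd"
        have nz: "z \<noteq> 0" "z + w \<noteq> 0" using z D_nz by (auto simp: Dm_def)
        have "z ^ j * (g m (z + w) - g m z) = c * (1 - (z / (z + w)) ^ j)"
          using assms(2)[OF w z(2)] by (simp add: T_def j)
        also have "\<dots> = z ^ j * (c / z ^ j - c / (z + w) ^ j)" using nz by (simp add: field_simps power_divide)
        finally have "g m (z + w) - g m z = c / z ^ j - c / (z + w) ^ j" using nz by simp
        moreover have "\<kappa> * (-1) ^ m * fact m = c" by (simp add: \<kappa>_def)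
        ultimately show "H m (z + w) = H m z" unfolding H_def j by (simp add: algebra_simps)
      qed
    qed
  next
    case (step i)
    show ?case
    proof (intro ballI)
      fix w z assume w: "w \<in> L" and z: "z \<in> Dm w"
      show "H i (z + w) = H i z"
        by (rule periodic_from_deriv[where H = "H i" and H' = "H (Suc i)" and i = i, OF dH _ scale w z])
           (use step.IH in auto)
    qed
  qed
  from this[of 0] show ?thesis by (intro exI[of _ \<kappa>]) (auto simp: H_def)
qed

text \<open>Compare the residues of \<open>F' / F + \<kappa> / z\<close> at \<open>0\<close> and at a lattice point.\<close>

lemma twist_integer:
  assumes "\<And>w z. w \<in> L \<Longrightarrow> z \<in> Dm w \<Longrightarrow> g 0 (z + w) + \<kappa> / (z + w) = g 0 z + \<kappa> / z"
  shows "\<kappa> \<in> \<int>"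
proof -
  obtain w where w: "w \<in> L" "w \<noteq> 0" using lattice_nonzero[OF lattice] by blast
  have lim: "(\<lambda>y. (y - x) * g 0 y) \<midarrow>x\<rightarrow> of_int (zorder F x)" for x
    unfolding g_def funpow_0
  proof (rule log_deriv_limit)
    show "eventually (\<lambda>z. F z \<noteq> 0) (at x)" by (rule eventually_cosparse_imp_eventually_at[OF nonzero]) auto
  qed (use mero meromorphic_on_subset in blast)
  have "(\<lambda>z. z * g 0 z + \<kappa>) \<midarrow>0\<rightarrow> of_int (zorder F 0) + \<kappa>"
    using lim[of 0] by (intro tendsto_intros) auto
  \<comment> \<open>The same limit computed at \<open>w\<close>: as \<open>w \<noteq> 0\<close>, the
    term \<open>\<kappa> / (z + w)\<close> stays bounded and only the order of \<open>F\<close> at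
    \<open>w\<close> remains.\<close>
  moreover have "(\<lambda>z. z * g 0 z + \<kappa>) \<midarrow>0\<rightarrow> of_int (zorder F w) + 0 * (\<kappa> / (0 + w))"
  proof (rule Lim_transform_eventually)
    have "filterlim (\<lambda>z. z + w) (at w) (at 0)" using filterlim_shift[of w 0] by simp
    from filterlim_compose[OF lim[of w] this] have "(\<lambda>z. z * g 0 (z + w)) \<midarrow>0\<rightarrow> of_int (zorder F w)" by simp
    thus "(\<lambda>z. z * g 0 (z + w) + z * (\<kappa> / (z + w))) \<midarrow>0\<rightarrow> of_int (zorder F w) + 0 * (\<kappa> / (0 + w))"
      by (intro tendsto_intros) (use w in auto)
    show "eventually (\<lambda>z. z * g 0 (z + w) + z * (\<kappa> / (z + w)) = z * g 0 z + \<kappa>) (at 0)"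
      using ev_Dm[of w 0]
    proof eventually_elim
      case (elim z)
      have "z \<noteq> 0" using elim D_nz by (auto simp: Dm_def)
      moreover have "z * g 0 (z + w) + z * (\<kappa> / (z + w)) = z * (g 0 z + \<kappa> / z)"
        using assms[OF w(1) elim] by (metis distrib_left)
      ultimately show ?case by (simp add: distrib_left)
    qed
  qed
  ultimately have "of_int (zorder F 0) + \<kappa> = of_int (zorder F w) + 0 * (\<kappa> / (0 + w))" by (rule LIM_unique)
  hence "\<kappa> = of_int (zorder F w - zorder F 0)" by (simp add: algebra_simps)
  thus ?thesis by simp
qed

text \<open>
  Here \<open>E (z + w) = X w * E z\<close> for a homomorphism \<open>X\<close> from \<open>L\<close> with \<open>X (q w) = X w\<close>, which is trivial on
  \<open>(q - 1) L\<close>.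
\<close>

lemma twist_elliptic:
  assumes "\<And>w z. w \<in> L \<Longrightarrow> z \<in> Dm w \<Longrightarrow> g 0 (z + w) + of_int n / (z + w) = g 0 z + of_int n / z"
  shows "remove_sings (\<lambda>z. F z * z powi n) \<in> elliptic_functions ((*) (of_nat (q - 1)) ` L)"
proof -
  define E where "E z = F z * z powi n" for z
  have E_nz: "E z \<noteq> 0" if "z \<in> D" for z using D_nz[OF that] by (simp add: E_def)
  \<comment> \<open>The hypothesis says that the logarithmic derivative of
    \<open>E (z + w) / E z\<close> vanishes.\<close>
  have "\<exists>c. \<forall>z\<in>Dm w. E (z + w) / E z = c" if w: "w \<in> L" for w
  proof (rule const_on_Dm)
    fix z assume z: "z \<in> Dm w"
    have nz: "z \<noteq> 0" "z + w \<noteq> 0" using z D_nz by (auto simp: Dm_def)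
    have alg: "(k * (y / a) * 1 * x - y * (k * (x / b) * 1)) / (x * x) = y / x * (k / a - k / b)"
      if "x \<noteq> 0" "a \<noteq> 0" "b \<noteq> 0" for k x y a b :: complex
      using that by (simp add: field_simps)
    have "((\<lambda>z. (z + w) powi n / z powi n) has_field_derivative (z + w) powi n / z powi n * (of_int n / (z + w) - of_int n / z)) (at z)"
      by (rule DERIV_cong[OF DERIV_divide[OF DERIV_power_int[OF DERIV_add[OF DERIV_ident DERIV_const]] DERIV_power_int[OF DERIV_ident]]])
         (use nz alg[of "z powi n" "z + w" z "of_int n" "(z + w) powi n"] in \<open>auto simp: power_int_diff\<close>)
    have alg2: "r * (c - d) * u + u * (k - l) * r = r * u * ((c + k) - (d + l))" for r c d u k l :: complex
      by (simp add: algebra_simps)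
    from DERIV_mult[OF ratio_deriv[OF z] \<open>((\<lambda>z. (z + w) powi n / z powi n) has_field_derivative _) (at z)\<close>]
    have "((\<lambda>z. F (z + w) / F z * ((z + w) powi n / z powi n)) has_field_derivative
       F (z + w) / F z * ((z + w) powi n / z powi n) * ((g 0 (z + w) + of_int n / (z + w)) - (g 0 z + of_int n / z))) (at z)"
      by (rule DERIV_cong) (rule alg2)
    thus "((\<lambda>z. E (z + w) / E z) has_field_derivative 0) (at z)" using assms[OF w z] by (simp add: E_def)
  qed
  then obtain X where X: "\<And>w z. w \<in> L \<Longrightarrow> z \<in> Dm w \<Longrightarrow> E (z + w) / E z = X w" by metis
  have X': "E (z + w) = X w * E z" if "w \<in> L" "z \<in> Dm w" for w z
    using X[OF that] E_nz[of z] that by (auto simp: Dm_def field_simps)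
  obtain y where y: "y \<in> Gd" using Gd_dense[of UNIV] by auto
  have pow: "X (of_nat k * w) = X w ^ k" if w: "w \<in> L" for k w
  proof -
    have "E (y + of_nat k * w) = X w ^ k * E y"
    proof (induction k)
      case (Suc k)
      have "y + of_nat k * w \<in> Dm w" by (intro Gd_Dm Gd_add y w lattice_of_nat lattice)
      from X'[OF w this] Suc show ?case by (simp add: algebra_simps)
    qed auto
    moreover have "of_nat k * w \<in> L" using lattice_of_nat[OF lattice w] .
    ultimately show ?thesis using X[OF _ Gd_Dm[OF y], of "of_nat k * w"] E_nz[OF Gd_D[OF y]] by simp
  qed
  have "X (of_nat (q - 1) * w) = 1" if w: "w \<in> L" for w
  proof -
    have qw: "of_nat q * w \<in> L" using lattice_of_nat[OF lattice w] .
    define z where "z = y / of_nat q"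
    have z: "z \<in> Dq w" unfolding z_def by (rule Gd_Dq[OF y w])
    hence zD: "z \<in> Dm w" "of_nat q * z \<in> Dm (of_nat q * w)" "of_nat q * z \<in> D" by (auto simp: Dq_def Dm_def)
    have nz: "z \<noteq> 0" "z + w \<noteq> 0" using zD D_nz by (auto simp: Dm_def)
    \<comment> \<open>The powers of \<open>q\<close> cancel in the twisting factor, so the quotients
      of \<open>E\<close> inherit the invariance from \<open>ratio_scale\<close>. With
      \<open>pow\<close> this becomes \<open>X w ^ q = X w\<close>.\<close>
    have "(of_nat q * z + of_nat q * w) powi n / (of_nat q * z) powi n = (z + w) powi n / z powi n"
      unfolding distrib_left[symmetric] power_int_mult_distrib by simp
    hence "E (of_nat q * z + of_nat q * w) / E (of_nat q * z) = E (z + w) / E z"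
      using ratio_scale[OF zD(1,3) w] unfolding E_def times_divide_times_eq[symmetric] by simp
    hence "X (of_nat q * w) = X w" using X[OF qw zD(2)] X[OF w zD(1)] by simp
    hence "X w ^ q = X w" using pow[OF w, of q] by simp
    moreover have "X w \<noteq> 0" using X[OF w zD(1)] E_nz[of z] E_nz[of "z + w"] zD(1) by (auto simp: Dm_def)
    moreover have "X w ^ q = X w * X w ^ (q - 1)" using q by (cases q) auto
    ultimately have "X w ^ (q - 1) = 1" by simp
    thus ?thesis using pow[OF w] by simp
  qed
  hence per: "E (z + of_nat (q - 1) * w) = E z" if "w \<in> L" "z \<in> Dm (of_nat (q - 1) * w)" for w z
    using X'[of "of_nat (q - 1) * w" z] lattice_of_nat[OF lattice, of w "q - 1"] that by simp
  \<comment> \<open>\<open>per\<close> holds only on \<open>Dm\<close>, hence in a punctured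
    neighbourhood of each point; \<open>remove_sings\<close> depends on nothing more.\<close>
  have "remove_sings E (z + v) = remove_sings E z" if v: "v \<in> (*) (of_nat (q - 1)) ` L" for v z
  proof -
    obtain w where w: "w \<in> L" "v = of_nat (q - 1) * w" using v by blast
    have "remove_sings (E \<circ> (\<lambda>x. x + v)) z = remove_sings E (z + v)"
      by (rule remove_sings_compose) (use filtermap_at_shift[of "- v" z] in simp)
    moreover have "remove_sings (E \<circ> (\<lambda>x. x + v)) z = remove_sings E z"
    proof (rule remove_sings_cong[OF _ refl])
      show "eventually (\<lambda>x. (E \<circ> (\<lambda>x. x + v)) x = E x) (at z)"
        using ev_Dm[of v z] by eventually_elim (use per w in auto)
    qed
    ultimately show ?thesis by simp
  qed
  moreover have "E meromorphic_on UNIV" unfolding E_def by (intro meromorphic_intros mero)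
  hence "remove_sings E nicely_meromorphic_on UNIV" by (rule remove_sings_nicely_meromorphic)
  ultimately show ?thesis unfolding elliptic_functions_def E_def [abs_def] by blast
qed

end

section \<open>From the differential equation to an elliptic function\<close>

text \<open>
  If \<open>v\<close> lists \<open>F\<close> followed by the derivatives of \<open>F' / F\<close>, then \<open>deriv_of_log v\<close> lists the derivatives
  of \<open>F\<close>, by the Leibniz rule for \<open>F' = (F' / F) F\<close>.
\<close>

fun deriv_of_log :: "(nat \<Rightarrow> complex) \<Rightarrow> nat \<Rightarrow> complex" where
  "deriv_of_log v 0 = v 0"
| "deriv_of_log v (Suc i) = (\<Sum>k\<le>i. of_nat (i choose k) * v (Suc k) * deriv_of_log v (i - k))"

text \<open>Solves the Leibniz recursion for its term \<open>k = i\<close>, whose coefficient is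
  \<open>x 0\<close>. This right inverse shows that substituting \<open>deriv_of_log\<close> does
  not annihilate a polynomial.\<close>

fun log_of_deriv :: "(nat \<Rightarrow> complex) \<Rightarrow> nat \<Rightarrow> complex" where
  "log_of_deriv x 0 = x 0"
| "log_of_deriv x (Suc i) =
     (x (Suc i) - (\<Sum>k<i. of_nat (i choose k) * log_of_deriv x (Suc k) * x (i - k))) / x 0"

declare log_of_deriv.simps(2) [simp del] \<comment> \<open>it unfolds forever below the sum\<close>

lemma deriv_of_log_of_deriv:
  assumes "x 0 \<noteq> 0"
  shows "deriv_of_log (log_of_deriv x) i = x i"
proof (induction i rule: less_induct)
  case (less i)
  show ?case
  proof (cases i)
    case (Suc n)
    have "deriv_of_log (log_of_deriv x) i = (\<Sum>k\<le>n. of_nat (n choose k) * log_of_deriv x (Suc k) * x (n - k))"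
      unfolding Suc deriv_of_log.simps by (intro sum.cong refl arg_cong2[of _ _ _ _ "(*)"] less.IH) (use Suc in auto)
    also have "\<dots> = (\<Sum>k<n. of_nat (n choose k) * log_of_deriv x (Suc k) * x (n - k)) + log_of_deriv x (Suc n) * x 0"
      by (simp only: lessThan_Suc_atMost[symmetric] sum.lessThan_Suc binomial_n_n of_nat_1 mult_1 diff_self_eq_0)
    also have "\<dots> = x i" using assms by (subst (2) log_of_deriv.simps(2)) (simp add: Suc)
    finally show ?thesis .
  qed auto
qed

lemma polyfun_deriv_of_log: "polyfun UNIV (\<lambda>v. deriv_of_log v i)"
proof (induction i rule: less_induct)
  case (less i)
  have var: "polyfun UNIV (\<lambda>v. v i)" for i
    using polyfun_mon[of "{#i#}" UNIV 1] by simp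
  show ?case
  proof (cases i)
    case 0
    thus ?thesis using var by simp
  next
    case (Suc n)
    have "polyfun UNIV (\<lambda>v. of_nat (n choose k) * v (Suc k) * deriv_of_log v (n - k))" if "k \<in> {..n}" for k
      by (rule polyfun_mult[OF polyfun_cmult[OF var] less.IH]) (use that Suc in auto)
    hence "polyfun UNIV (\<lambda>v. \<Sum>k\<le>n. of_nat (n choose k) * v (Suc k) * deriv_of_log v (n - k))"
      by (rule polyfun_sum)
    thus ?thesis by (simp add: Suc)
  qed
qed

lemma ev_compose:
  assumes "\<And>i. polyfun UNIV (\<lambda>v. p v i)"
  shows "\<exists>Q. \<forall>v. ev Q v = ev P (p v)"
proof -
  have "polyfun UNIV (\<lambda>v. mon M (p v))" for M
  proof (induction M)
    case empty
    show ?case using polyfun_mon[of "{#}" UNIV 1] by simp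
  next
    case (add i M)
    show ?case using polyfun_mult[OF assms[of i] add] by simp
  qed
  hence "polyfun UNIV (\<lambda>v. ev P (p v))" unfolding ev_def by (intro polyfun_sum polyfun_cmult)
  from polyfun_imp_ev[OF this] show ?thesis by (metis (no_types))
qed

text \<open>Translates exponent maps, the monomials of the given differential polynomial, into
  multisets. Injectivity keeps coefficients of different monomials apart.\<close>

definition mset_of :: "(nat \<Rightarrow>\<^sub>0 nat) \<Rightarrow> nat multiset" where
  "mset_of m = (\<Sum>i\<in>Poly_Mapping.keys m. replicate_mset (Poly_Mapping.lookup m i) i)"

lemma count_mset_of: "count (mset_of m) i = Poly_Mapping.lookup m i"
  by (auto simp: mset_of_def count_sum in_keys_iff)

lemma inj_mset_of: "inj mset_of"
  by (rule injI) (metis count_mset_of poly_mapping_eqI)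

lemma mon_mset_of: "mon (mset_of m) v = (\<Prod>i\<in>Poly_Mapping.keys m. v i ^ Poly_Mapping.lookup m i)"
proof -
  have "mon (\<Sum>i\<in>A. f i) v = (\<Prod>i\<in>A. mon (f i) v)" for A :: "nat set" and f
    by (induction A rule: infinite_finite_induct) (auto simp: mon_union)
  thus ?thesis by (simp add: mset_of_def mon_replicate)
qed

context q_solution begin

lemma higher_deriv_F: "z \<in> D \<Longrightarrow> (deriv ^^ i) F z = deriv_of_log (J z) i"
proof (induction i arbitrary: z rule: less_induct)
  case (less i)
  show ?case
  proof (cases i)
    case 0
    thus ?thesis by (simp add: J_def)
  next
    case (Suc n)
    have "eventually (\<lambda>w. w \<in> D) (nhds z)" by (rule eventually_nhds_in_open[OF open_D less.prems])
    hence ev: "eventually (\<lambda>w. deriv F w = g 0 w * F w) (nhds z)"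
      by eventually_elim (use D_nz in \<open>auto simp: g_def\<close>)
    have "(deriv ^^ i) F z = (deriv ^^ n) (deriv F) z" unfolding Suc funpow_Suc_right by simp
    also have "\<dots> = (deriv ^^ n) (\<lambda>w. g 0 w * F w) z"
      by (rule higher_deriv_cong_ev[OF ev refl])
    also have "\<dots> = (\<Sum>k\<le>n. of_nat (n choose k) * (deriv ^^ k) (g 0) z * (deriv ^^ (n - k)) F z)"
      using higher_deriv_mult[OF g_holo F_holo open_D less.prems, of n 0] by (simp add: atLeast0AtMost)
    also have "\<dots> = (\<Sum>k\<le>n. of_nat (n choose k) * J z (Suc k) * deriv_of_log (J z) (n - k))"
      by (intro sum.cong refl arg_cong2[of _ _ _ _ "(*)"] less.IH)
         (use less.prems Suc in \<open>auto simp: J_def g_def\<close>)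
    finally show ?thesis by (simp add: Suc)
  qed
qed

text \<open>The coefficients are \<open>L\<close>-periodic and so take the same values at all
  \<open>\<tau> + w\<close>. At these points the differential equation is a single polynomial
  relation with constant coefficients.\<close>

lemma algebraic_relation:
  assumes "finite M" "m0 \<in> M" and A: "\<And>m. m \<in> M \<Longrightarrow> A m nicely_meromorphic_on UNIV"
    and per: "\<And>m w z. m \<in> M \<Longrightarrow> w \<in> L \<Longrightarrow> A m (z + w) = A m z"
    and nz: "frequently (\<lambda>z. A m0 z \<noteq> 0) (at 0)"
    and zero: "eventually (\<lambda>z. (\<Sum>m\<in>M. A m z * (\<Prod>i\<in>Poly_Mapping.keys m. (deriv ^^ i) F z ^ Poly_Mapping.lookup m i)) = 0) (at 0)"
  shows "\<exists>\<tau>\<in>Gd. \<exists>P. P \<noteq> 0 \<and> (\<forall>w\<in>L. ev P (J (\<tau> + w)) = 0)"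
proof -
  have Am: "A m meromorphic_on UNIV" if "m \<in> M" for m using A[OF that] by (simp add: nicely_meromorphic_on_def)
  have cs: "countable {z. \<not> p z}" if "eventually p (cosparse UNIV)" for p :: "complex \<Rightarrow> bool"
    using sparse_imp_countable[of UNIV "{z. \<not> p z}"] that by (simp add: eventually_cosparse)
  have "\<not> eventually (\<lambda>z. A m0 z = 0) (cosparse UNIV)"
    using nz eventually_cosparse_imp_eventually_at[of "\<lambda>z. A m0 z = 0" UNIV 0 UNIV] by (auto simp: frequently_def)
  with meromorphic_imp_constant_or_avoid[OF Am[OF assms(2)], of 0]
  have 1: "eventually (\<lambda>z. A m0 z \<noteq> 0) (cosparse UNIV)" by auto
  \<comment> \<open>Each requirement on \<open>\<tau>\<close> fails only on a countable set, so some
    point of the plane meets all of them.\<close>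
  have "countable (- Gd \<union> {z. \<not> A m0 z \<noteq> 0} \<union> (\<Union>m\<in>M. {z. \<not> A m analytic_on {z}}))"
    by (intro countable_Un countable_UN countable_Gd cs 1 meromorphic_on_imp_analytic_cosparse Am countable_finite assms(1))
  moreover have "uncountable (UNIV :: complex set)" by (rule uncountable_UNIV_complex)
  ultimately obtain \<tau> where "\<tau> \<notin> - Gd \<union> {z. \<not> A m0 z \<noteq> 0} \<union> (\<Union>m\<in>M. {z. \<not> A m analytic_on {z}})"
    by (metis UNIV_eq_I)
  hence \<tau>: "\<tau> \<in> Gd" "A m0 \<tau> \<noteq> 0" "\<And>m. m \<in> M \<Longrightarrow> A m analytic_on {\<tau>}" by auto
  define l where "l m = Poly_Mapping.single (mset_of m) (A m \<tau>)" for m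
  define P where "P = (\<Sum>m\<in>M. l m)"
  have ev_P: "ev P v = (\<Sum>m\<in>M. A m \<tau> * (\<Prod>i\<in>Poly_Mapping.keys m. v i ^ Poly_Mapping.lookup m i))" for v
  proof -
    have "ev (\<Sum>m\<in>B. l m) v = (\<Sum>m\<in>B. ev (l m) v)" for B
      by (induction B rule: infinite_finite_induct) (auto simp: ev_add)
    thus ?thesis by (simp add: P_def l_def ev_single mon_mset_of)
  qed
  have "Poly_Mapping.lookup P (mset_of m0) = (\<Sum>m\<in>M. if m = m0 then A m0 \<tau> else 0)"
    unfolding P_def lookup_sum by (intro sum.cong) (auto simp: l_def lookup_single inj_eq[OF inj_mset_of])
  also have "\<dots> \<noteq> 0" using assms(1,2) \<tau>(2) by simp
  finally have "P \<noteq> 0" by auto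
  \<comment> \<open>\<open>Q\<close> restates the relation in terms of \<open>F\<close> and the
    derivatives of \<open>F' / F\<close>, the coordinates of \<open>J\<close>.\<close>
  obtain Q where Q: "\<And>v. ev Q v = ev P (deriv_of_log v)"
    using ev_compose[of "deriv_of_log" P] polyfun_deriv_of_log by auto
  have "Q \<noteq> 0"
  proof -
    obtain v where v: "\<forall>i. v i \<noteq> 0" "ev P v \<noteq> 0" using ev_nonzero[OF \<open>P \<noteq> 0\<close>] by blast
    have "deriv_of_log (log_of_deriv v) = v" using deriv_of_log_of_deriv v(1) by auto
    thus ?thesis using Q[of "log_of_deriv v"] v(2) by auto
  qed
  moreover have "ev Q (J (\<tau> + w)) = 0" if w: "w \<in> L" for w
  proof -
    define W where "W z = (\<Sum>m\<in>M. A m z * (\<Prod>i\<in>Poly_Mapping.keys m. (deriv ^^ i) F z ^ Poly_Mapping.lookup m i))" for z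
    have z: "\<tau> + w \<in> D" using Gd_Dm[OF \<tau>(1) w] by (simp add: Dm_def)
    have "W meromorphic_on UNIV"
      unfolding W_def by (intro meromorphic_intros Am mero) auto
    from meromorphic_imp_constant_or_avoid[OF this, of 0] have "eventually (\<lambda>z. W z = 0) (cosparse UNIV)"
    proof
      assume "eventually (\<lambda>z. W z \<noteq> 0) (cosparse UNIV)"
      hence "eventually (\<lambda>z. W z \<noteq> 0) (at 0)" by (rule eventually_cosparse_imp_eventually_at) auto
      with zero have "eventually (\<lambda>z. False) (at (0::complex))" unfolding W_def by eventually_elim auto
      thus ?thesis by simp
    qed auto
    hence "eventually (\<lambda>z. W z = 0) (at (\<tau> + w))" by (rule eventually_cosparse_imp_eventually_at) auto
    hence "W \<midarrow>\<tau> + w\<rightarrow> 0" using tendsto_eventually by blast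
    moreover have "isCont W (\<tau> + w)"
    proof -
      \<comment> \<open>\<open>\<tau>\<close> was chosen so that \<open>A m\<close> is analytic
        there; periodicity carries continuity over to \<open>\<tau> + w\<close>.\<close>
      have "isCont (A m) (\<tau> + w)" if m: "m \<in> M" for m
      proof -
        have "isCont (A m) (\<tau> + w - w)" using \<tau>(3)[OF m] analytic_at_imp_isCont by simp
        hence "isCont (\<lambda>z. A m (z - w)) (\<tau> + w)" by (rule isCont_o2[rotated]) (auto intro!: continuous_intros)
        moreover have "A m (z - w) = A m z" for z using per[OF m w, of "z - w"] by simp
        ultimately show ?thesis by simp
      qed
      moreover have "isCont ((deriv ^^ i) F) (\<tau> + w)" for i
        using holomorphic_higher_deriv[OF F_holo open_D] z open_D
        by (meson continuous_on_eq_continuous_at holomorphic_on_imp_continuous_on)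
      ultimately show ?thesis unfolding W_def by (intro continuous_intros) auto
    qed
    ultimately have "W (\<tau> + w) = 0" using isContD LIM_unique by blast
    moreover have "W (\<tau> + w) = ev P (\<lambda>i. (deriv ^^ i) F (\<tau> + w))"
      unfolding W_def ev_P using per w by simp
    moreover have "(\<lambda>i. (deriv ^^ i) F (\<tau> + w)) = deriv_of_log (J (\<tau> + w))" using higher_deriv_F[OF z] by auto
    ultimately show ?thesis by (simp add: Q)
  qed
  ultimately show ?thesis using \<tau>(1) by blast
qed

end

theorem theorem9p2:
  fixes L0 :: "complex set" and q :: nat and a f :: "complex fls"
  assumes "is_lattice L0"
    and "q \<ge> 2"
    and "a \<in> ell_field L0"
    and "phi q f = a * f"
    and "diff_algebraic_over (ell_field L0) f"
  shows "\<exists>r::int. fls_X_intpow (- r) * f \<in> ell_field L0"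
proof (cases "f = 0")
  case True
  thus ?thesis using ell_field_0[OF assms(1)] by simp
next
  case f: False
  obtain La \<alpha> where \<alpha>: "La \<in> commensurability_class L0" "\<alpha> \<in> elliptic_functions La" "\<alpha> has_laurent_expansion a"
    using assms(3) unfolding ell_field_def by blast
  obtain r P where P: "P \<in> mvpoly_ring (ell_field L0) r" "P \<noteq> 0" "mvpoly_eval P (\<lambda>i. (fls_deriv ^^ i) f) = 0"
    using assms(5) unfolding diff_algebraic_over_def by blast
  define M where "M = Poly_Mapping.keys P"
  have "\<forall>m\<in>M. \<exists>L A. L \<in> commensurability_class L0 \<and> A \<in> elliptic_functions L \<and> A has_laurent_expansion Poly_Mapping.lookup P m"
    using P(1) unfolding mvpoly_ring_def ell_field_def M_def by blast
  then obtain Lc A where A: "\<And>m. m \<in> M \<Longrightarrow> Lc m \<in> commensurability_class L0"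
    "\<And>m. m \<in> M \<Longrightarrow> A m \<in> elliptic_functions (Lc m)" "\<And>m. m \<in> M \<Longrightarrow> A m has_laurent_expansion Poly_Mapping.lookup P m"
    by metis
  have "insert La (Lc ` M) \<subseteq> commensurability_class L0" "finite (insert La (Lc ` M))"
    using \<alpha>(1) A(1) by (auto simp: M_def)
  then obtain N where N: "N > 0" "\<And>L. L \<in> insert La (Lc ` M) \<Longrightarrow> (*) (of_nat N) ` L0 \<subseteq> L"
    using common_multiple_lattice[OF assms(1)] by metis
  \<comment> \<open>One lattice of periods for \<open>\<alpha>\<close> and for all coefficients of
    the differential equation.\<close>
  define L where "L = (*) (of_nat N :: complex) ` L0"
  have \<alpha>_mero: "\<alpha> meromorphic_on UNIV" using \<alpha>(2) by (auto simp: elliptic_functions_def nicely_meromorphic_on_def)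
  obtain F where F: "F meromorphic_on UNIV" "F has_laurent_expansion f" "\<And>z. z \<noteq> 0 \<Longrightarrow> F (of_nat q * z) = \<alpha> z * F z"
    using global_extension[OF assms(2) f assms(4) \<alpha>(3) \<alpha>_mero] by blast
  have ev_nz: "eventually (\<lambda>z. F z \<noteq> 0) (at 0)"
    by (rule has_laurent_expansion_nonzero_imp_eventually_nonzero[OF F(2) f])
  interpret q_solution L q \<alpha> F
  proof
    show "is_lattice L" unfolding L_def by (rule is_lattice_scale[OF assms(1) N(1)])
    show "\<alpha> (z + w) = \<alpha> z" if "w \<in> L" for w z
      using that N(2)[of La] \<alpha>(2) unfolding L_def elliptic_functions_def by blast
    show "eventually (\<lambda>z. F z \<noteq> 0) (cosparse UNIV)"
      using meromorphic_imp_constant_or_avoid[OF F(1), of 0]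
    proof
      assume "eventually (\<lambda>z. F z = 0) (cosparse UNIV)"
      hence "eventually (\<lambda>z. F z = 0) (at 0)" by (rule eventually_cosparse_imp_eventually_at) auto
      with ev_nz have "eventually (\<lambda>z. False) (at (0::complex))" by eventually_elim auto
      thus ?thesis by simp
    qed auto
  qed (use assms F in auto)
  have dF: "(deriv ^^ i) F has_laurent_expansion (fls_deriv ^^ i) f" for i
    by (induction i) (auto intro!: laurent_expansion_intros F)
  obtain m0 where m0: "m0 \<in> M" using P(2) unfolding M_def by (metis ex_in_conv keys_eq_empty)
  have "\<exists>\<tau>\<in>Gd. \<exists>P. P \<noteq> 0 \<and> (\<forall>w\<in>L. ev P (J (\<tau> + w)) = 0)"
  proof (rule algebraic_relation)
    show "finite M" by (simp add: M_def)
    show "A m nicely_meromorphic_on UNIV" if "m \<in> M" for m using A(2)[OF that] by (simp add: elliptic_functions_def)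
    show "A m (z + w) = A m z" if "m \<in> M" "w \<in> L" for m w z
      using N(2)[of "Lc m"] A(2)[OF that(1)] that unfolding L_def elliptic_functions_def by blast
    show "frequently (\<lambda>z. A m0 z \<noteq> 0) (at 0)"
      using has_laurent_expansion_nonzero_imp_eventually_nonzero[OF A(3)[OF m0]] m0
      by (intro eventually_frequently) (auto simp: M_def in_keys_iff)
    have "(\<lambda>z. \<Sum>m\<in>M. A m z * (\<Prod>i\<in>Poly_Mapping.keys m. (deriv ^^ i) F z ^ Poly_Mapping.lookup m i))
       has_laurent_expansion mvpoly_eval P (\<lambda>i. (fls_deriv ^^ i) f)"
      unfolding mvpoly_eval_def M_def[symmetric] by (intro laurent_expansion_intros A dF)
    thus "eventually (\<lambda>z. (\<Sum>m\<in>M. A m z * (\<Prod>i\<in>Poly_Mapping.keys m. (deriv ^^ i) F z ^ Poly_Mapping.lookup m i)) = 0) (at 0)"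
      using has_laurent_expansion_eventually_zero_iff[where z = 0] unfolding P(3) by simp
  qed (use m0 in auto)
  then obtain \<tau> Q where Q: "\<tau> \<in> Gd" "Q \<noteq> 0" "\<And>w. w \<in> L \<Longrightarrow> ev Q (J (\<tau> + w)) = 0" by blast
  obtain j c where jc: "j > 0" "\<And>w z. w \<in> L \<Longrightarrow> z \<in> Gd \<Longrightarrow> T w z j = c * (1 - (z / (z + w)) ^ j)"
    using linear_relation[OF Q] by blast
  obtain \<kappa> where \<kappa>: "\<And>w z. w \<in> L \<Longrightarrow> z \<in> Dm w \<Longrightarrow> g 0 (z + w) + \<kappa> / (z + w) = g 0 z + \<kappa> / z"
    using log_deriv_periodic[OF jc] by blast
  obtain n where n: "\<kappa> = of_int n" using twist_integer[OF \<kappa>] by (auto elim: Ints_cases)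
  have E: "remove_sings (\<lambda>z. F z * z powi n) \<in> elliptic_functions ((*) (of_nat (q - 1)) ` L)"
    by (rule twist_elliptic) (use \<kappa> n in auto)
  \<comment> \<open>The periods left after trivialising the character form a multiple of
    \<open>L0\<close> by a positive integer, since \<open>q \<ge> 2\<close>, hence a commensurable
    lattice.\<close>
  have "(*) (of_nat (q - 1)) ` L = (*) (of_nat ((q - 1) * N)) ` L0"
    by (simp add: L_def image_image mult.assoc)
  also have "\<dots> \<in> commensurability_class L0"
    by (rule scale_in_commensurability_class) (use assms N in auto)
  finally have "(*) (of_nat (q - 1)) ` L \<in> commensurability_class L0" .
  moreover have "remove_sings (\<lambda>z. F z * z powi n) has_laurent_expansion fls_X_intpow n * f"
    using remove_sings_has_laurent_expansion[OF has_laurent_expansion_shift[OF F(2), of n]]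
    by (simp add: fls_X_intpow_times_conv_shift)
  \<comment> \<open>Multiplication by \<open>z powi n\<close> corresponds to the witness
    \<open>r = - n\<close>.\<close>
  ultimately have "fls_X_intpow (- (- n)) * f \<in> ell_field L0"
    using E unfolding ell_field_def by auto
  thus ?thesis by blast
qed

end
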